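(* Let $K$ be an algebraically closed field and let $A=KQ/I$ be a finite dimensional $K$-algebra, with $Q$ a finite quiver and $I$ an admissible ideal, such that $\dim_K \mathrm{Ext}^1_A(S,T)\leq 1$ for all simple $A$-modules $S$ and $T$. Suppose that $\Sigma_0(A)$ is empty. Then $\mathrm{HH}^1(A)$ is a solvable Lie algebra.
   Context: $\mathrm{HH}^1(A)=\mathrm{Der}_K(A)/\mathrm{Inn}(A)$, with Lie bracket induced by the commutator of derivations. $Q_0$ is the set of vertices and $Q_1$ the set of arrows of $Q$; $Q_1$ and $Q_0$ are identified with their images in $A$. Fix a $K$-basis $\mathcal{B}$ of $A$ consisting of the classes of paths that cannot be reduced modulo $I$ (the paths that are not leading terms of elements of $I$ for a fixed order on paths); it contains all vertices and all arrows. An element $\alpha\|\beta$, with $\alpha\in Q_1$ and $\beta\in\mathcal{B}$ parallel (same source and same target), denotes the linear map sending the arrow $\alpha$ to $\beta$ and all other arrows to $0$. A linear combination $x=\sum_j\lambda_j\,\alpha_j\|\beta_j$ of pairwise distinct such elements lies in $\ker(\delta^1)$ if and only if there is a $K$-linear derivation $d$ of $A$ with $d(e)=0$ for all $e\in Q_0$ and $d(\alpha)=\sum_{j:\alpha_j=\alpha}\lambda_j\beta_j$ for every arrow $\alpha$. $\Sigma_0(A)$ is the set of all $\alpha\|e$, where $\alpha$ is a loop at a vertex $e$, such that $\alpha\|e$ occurs with nonzero coefficient in some element of $\ker(\delta^1)$. Thus $\Sigma_0(A)$ is empty if and only if there is no derivation of $A$ vanishing on $Q_0$ that sends some loop $\alpha$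 at a vertex $e$ to a linear combination of basis paths in which $e$ has nonzero coefficient. *)

theory Defs
  imports
    "Graph_Theory.Arc_Walk"
    "HOL-Algebra.QuotRing"
    "HOL-Algebra.Module"
    "HOL-Algebra.Algebraic_Closure_Type"
    "HOL-Library.Extended_Nat"
    "HOL-Library.FuncSet"
begin

text \<open>
  The ground field is a type of class \<open>field\<close>.  Vector spaces over it, associative algebras, modules
  and Lie algebras are all given by \<open>module\<close> records; the fields \<open>mult\<close> and \<open>one\<close> of the record are
  meaningful for associative algebras only and are \<open>undefined\<close> otherwise.
\<close>

section \<open>Vector spaces\<close>

abbreviation scalars :: "'k::field ring" where
  "scalars \<equiv> ring_of_type_algebra"

definition lin_span :: "('k::field, 'b, 'z) module_scheme \<Rightarrow> 'b set \<Rightarrow> 'b set" where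
  "lin_span V B = \<Inter>{W. submodule W scalars V \<and> B \<subseteq> W}"

text \<open>The least cardinality of a finite spanning set, and \<open>\<infinity>\<close> if there is none.\<close>

definition vs_dim :: "('k::field, 'b, 'z) module_scheme \<Rightarrow> enat" where
  "vs_dim V = Inf {enat (card B) | B. finite B \<and> B \<subseteq> carrier V \<and> lin_span V B = carrier V}"

definition quot_module :: "('k, 'b, 'z) module_scheme \<Rightarrow> 'b set \<Rightarrow> ('k, 'b set) module" where
  "quot_module V W =
     \<lparr> carrier = a_rcosets\<^bsub>V\<^esub> W,
       monoid.mult = undefined,
       one = undefined,
       ring.zero = W,
       add = set_add V,
       module.smult = (\<lambda>c C. \<Union>x\<in>C. W +>\<^bsub>V\<^esub> (c \<odot>\<^bsub>V\<^esub> x)) \<rparr>"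

section \<open>Bound quiver algebras\<close>

text \<open>
  A quiver is a multidigraph with loops; \<open>fin_digraph\<close> says that it is finite.  A path is a triple
  (source, list of arrows, target), so that \<open>(v, [], v)\<close> is the trivial path at \<open>v\<close>.
  Paths are composed from left to right.
\<close>

type_synonym ('v, 'e) qpath = "'v \<times> 'e list \<times> 'v"

definition paths :: "('v, 'e) pre_digraph \<Rightarrow> ('v, 'e) qpath set" where
  "paths Q = {(u, es, v). pre_digraph.awalk Q u es v}"

definition path_length :: "('v, 'e) qpath \<Rightarrow> nat" where
  "path_length p = length (fst (snd p))"

definition vertex_path :: "'v \<Rightarrow> ('v, 'e) qpath" where
  "vertex_path v = (v, [], v)"

definition arrow_path :: "('v, 'e) pre_digraph \<Rightarrow> 'e \<Rightarrow> ('v, 'e) qpath" where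
  "arrow_path Q a = (tail Q a, [a], head Q a)"

definition factorizations ::
    "('v, 'e) pre_digraph \<Rightarrow> ('v, 'e) qpath \<Rightarrow> (('v, 'e) qpath \<times> ('v, 'e) qpath) set" where
  "factorizations Q p =
     {((u, es, w), (w', fs, v)) | u es w w' fs v.
        (u, es, w) \<in> paths Q \<and> (w', fs, v) \<in> paths Q \<and> w = w' \<and> p = (u, es @ fs, v)}"

text \<open>An element of the path algebra is the finitely supported function of its coefficients.\<close>

definition path_algebra ::
    "('v, 'e) pre_digraph \<Rightarrow> ('k::field, ('v, 'e) qpath \<Rightarrow> 'k) module" where
  "path_algebra Q =
     \<lparr> carrier = {f. finite {p. f p \<noteq> 0} \<and> {p. f p \<noteq> 0} \<subseteq> paths Q},
       monoid.mult = (\<lambda>f g p. \<Sum>(q, r)\<in>factorizations Q p. f q * g r),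
       one = (\<lambda>p. if p \<in> vertex_path ` verts Q then 1 else 0),
       ring.zero = (\<lambda>p. 0),
       add = (\<lambda>f g p. f p + g p),
       module.smult = (\<lambda>c f p. c * f p) \<rparr>"

definition path_elem :: "('v, 'e) qpath \<Rightarrow> ('v, 'e) qpath \<Rightarrow> 'k::field" where
  "path_elem p = (\<lambda>q. if q = p then 1 else 0)"

text \<open>The \<open>m\<close>-th power of the arrow ideal is the span of the paths of length at least \<open>m\<close>.\<close>

definition arrow_ideal_power ::
    "('v, 'e) pre_digraph \<Rightarrow> nat \<Rightarrow> (('v, 'e) qpath \<Rightarrow> 'k::field) set" where
  "arrow_ideal_power Q m =
     {f \<in> carrier (path_algebra Q). \<forall>p. f p \<noteq> 0 \<longrightarrow> m \<le> path_length p}"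

definition admissible_ideal ::
    "('v, 'e) pre_digraph \<Rightarrow> (('v, 'e) qpath \<Rightarrow> 'k::field) set \<Rightarrow> bool" where
  "admissible_ideal Q I \<longleftrightarrow>
     ideal I (path_algebra Q) \<and>
     I \<subseteq> arrow_ideal_power Q 2 \<and>
     (\<exists>m\<ge>2. arrow_ideal_power Q m \<subseteq> I)"

definition quot_algebra :: "('k, 'b, 'z) module_scheme \<Rightarrow> 'b set \<Rightarrow> ('k, 'b set) module" where
  "quot_algebra R I =
     \<lparr> carrier = carrier (R Quot I),
       monoid.mult = monoid.mult (R Quot I),
       one = one (R Quot I),
       ring.zero = ring.zero (R Quot I),
       add = add (R Quot I),
       module.smult = (\<lambda>c C. \<Union>x\<in>C. I +>\<^bsub>R\<^esub> (c \<odot>\<^bsub>R\<^esub> x)) \<rparr>"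

type_synonym ('v, 'e, 'k) bqa_elem = "(('v, 'e) qpath \<Rightarrow> 'k) set"

definition bound_quiver_algebra ::
    "('v, 'e) pre_digraph \<Rightarrow> (('v, 'e) qpath \<Rightarrow> 'k::field) set
       \<Rightarrow> ('k, ('v, 'e, 'k) bqa_elem) module" where
  "bound_quiver_algebra Q I = quot_algebra (path_algebra Q) I"

definition bqa_class ::
    "('v, 'e) pre_digraph \<Rightarrow> (('v, 'e) qpath \<Rightarrow> 'k::field) set
       \<Rightarrow> (('v, 'e) qpath \<Rightarrow> 'k) \<Rightarrow> ('v, 'e, 'k) bqa_elem" where
  "bqa_class Q I f = I +>\<^bsub>path_algebra Q\<^esub> f"

section \<open>Modules over an algebra and their first extension spaces\<close>

text \<open>The library's \<open>module\<close> is restricted to commutative base rings.\<close>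

locale left_module = A?: ring A + M?: abelian_group M
  for A :: "('a, 'r) ring_scheme" (structure)
  and M :: "('a, 'm, 'z) module_scheme" (structure) +
  assumes smult_closed:
      "\<lbrakk>a \<in> carrier A; x \<in> carrier M\<rbrakk> \<Longrightarrow> a \<odot>\<^bsub>M\<^esub> x \<in> carrier M"
    and smult_l_distr:
      "\<lbrakk>a \<in> carrier A; b \<in> carrier A; x \<in> carrier M\<rbrakk>
        \<Longrightarrow> (a \<oplus>\<^bsub>A\<^esub> b) \<odot>\<^bsub>M\<^esub> x = a \<odot>\<^bsub>M\<^esub> x \<oplus>\<^bsub>M\<^esub> b \<odot>\<^bsub>M\<^esub> x"
    and smult_r_distr:
      "\<lbrakk>a \<in> carrier A; x \<in> carrier M; y \<in> carrier M\<rbrakk>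
        \<Longrightarrow> a \<odot>\<^bsub>M\<^esub> (x \<oplus>\<^bsub>M\<^esub> y) = a \<odot>\<^bsub>M\<^esub> x \<oplus>\<^bsub>M\<^esub> a \<odot>\<^bsub>M\<^esub> y"
    and smult_assoc:
      "\<lbrakk>a \<in> carrier A; b \<in> carrier A; x \<in> carrier M\<rbrakk>
        \<Longrightarrow> (a \<otimes>\<^bsub>A\<^esub> b) \<odot>\<^bsub>M\<^esub> x = a \<odot>\<^bsub>M\<^esub> (b \<odot>\<^bsub>M\<^esub> x)"
    and smult_one:
      "x \<in> carrier M \<Longrightarrow> \<one>\<^bsub>A\<^esub> \<odot>\<^bsub>M\<^esub> x = x"

text \<open>
  Every simple \<open>A\<close>-module is a quotient of the regular module by a left ideal, so choosing coset
  representatives gives an isomorphic module whose carrier is a subset of the carrier of \<open>A\<close>.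
  Quantifying over all simple modules with elements in the element type of \<open>A\<close> therefore covers
  every simple module up to isomorphism.
\<close>

definition simple_module ::
    "('a, 'r) ring_scheme \<Rightarrow> ('a, 'm, 'z) module_scheme \<Rightarrow> bool" where
  "simple_module A S \<longleftrightarrow>
     left_module A S \<and> carrier S \<noteq> {\<zero>\<^bsub>S\<^esub>} \<and>
     (\<forall>N. submodule N A S \<longrightarrow> N = {\<zero>\<^bsub>S\<^esub>} \<or> N = carrier S)"

definition module_homs ::
    "('a, 'r) ring_scheme \<Rightarrow> ('a, 'm, 'y) module_scheme \<Rightarrow> ('a, 'n, 'z) module_scheme
       \<Rightarrow> ('m \<Rightarrow> 'n) set" where
  "module_homs A M N =
     {f \<in> carrier M \<rightarrow>\<^sub>E carrier N.
        (\<forall>x\<in>carrier M. \<forall>y\<in>carrier M. f (x \<oplus>\<^bsub>M\<^esub> y) = f x \<oplus>\<^bsub>N\<^esub> f y) \<and>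
        (\<forall>a\<in>carrier A. \<forall>x\<in>carrier M. f (a \<odot>\<^bsub>M\<^esub> x) = a \<odot>\<^bsub>N\<^esub> f x)}"

text \<open>The ground field acts on an \<open>A\<close>-module through the multiples of the identity of \<open>A\<close>.\<close>

definition hom_space ::
    "('k, 'a, 'r) module_scheme \<Rightarrow> ('a, 'm, 'y) module_scheme \<Rightarrow> ('a, 'n, 'z) module_scheme
       \<Rightarrow> ('k, 'm \<Rightarrow> 'n) module" where
  "hom_space A M N =
     \<lparr> carrier = module_homs A M N,
       monoid.mult = undefined,
       one = undefined,
       ring.zero = (\<lambda>x\<in>carrier M. \<zero>\<^bsub>N\<^esub>),
       add = (\<lambda>f g. \<lambda>x\<in>carrier M. f x \<oplus>\<^bsub>N\<^esub> g x),
       module.smult = (\<lambda>c f. \<lambda>x\<in>carrier M. (c \<odot>\<^bsub>A\<^esub> \<one>\<^bsub>A\<^esub>) \<odot>\<^bsub>N\<^esub> f x) \<rparr>"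

definition free_module :: "('a, 'r) ring_scheme \<Rightarrow> 'x set \<Rightarrow> ('a, 'x \<Rightarrow> 'a) module" where
  "free_module A B =
     \<lparr> carrier = {\<phi>. (\<forall>x. \<phi> x \<in> carrier A) \<and> finite {x. \<phi> x \<noteq> \<zero>\<^bsub>A\<^esub>} \<and> {x. \<phi> x \<noteq> \<zero>\<^bsub>A\<^esub>} \<subseteq> B},
       monoid.mult = undefined,
       one = undefined,
       ring.zero = (\<lambda>x. \<zero>\<^bsub>A\<^esub>),
       add = (\<lambda>\<phi> \<psi> x. \<phi> x \<oplus>\<^bsub>A\<^esub> \<psi> x),
       module.smult = (\<lambda>a \<phi> x. a \<otimes>\<^bsub>A\<^esub> \<phi> x) \<rparr>"

text \<open>
  \<open>cover A S\<close> is the canonical epimorphism onto \<open>S\<close> from the free module on the underlying set of \<open>S\<close>,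
  and \<open>syzygy A S\<close> is its kernel.
\<close>

definition cover ::
    "('a, 'r) ring_scheme \<Rightarrow> ('a, 'm, 'z) module_scheme \<Rightarrow> ('m \<Rightarrow> 'a) \<Rightarrow> 'm" where
  "cover A S \<phi> = (\<Oplus>\<^bsub>S\<^esub> s\<in>{s. \<phi> s \<noteq> \<zero>\<^bsub>A\<^esub>}. \<phi> s \<odot>\<^bsub>S\<^esub> s)"

definition syzygy ::
    "('a, 'r) ring_scheme \<Rightarrow> ('a, 'm, 'z) module_scheme \<Rightarrow> ('a, 'm \<Rightarrow> 'a) module" where
  "syzygy A S =
     (free_module A (carrier S))
       \<lparr> carrier := {\<phi> \<in> carrier (free_module A (carrier S)). cover A S \<phi> = \<zero>\<^bsub>S\<^esub>} \<rparr>"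

text \<open>
  With \<open>0 \<rightarrow> \<Omega> \<rightarrow> F \<rightarrow> S \<rightarrow> 0\<close> the canonical free presentation of \<open>S\<close>, the space \<open>Ext\<^sup>1(S, T)\<close> is the
  cokernel of the restriction map \<open>Hom(F, T) \<rightarrow> Hom(\<Omega>, T)\<close>.
\<close>

definition Ext1 ::
    "('k, 'a, 'r) module_scheme \<Rightarrow> ('a, 'm, 'y) module_scheme \<Rightarrow> ('a, 'n, 'z) module_scheme
       \<Rightarrow> ('k, (('m \<Rightarrow> 'a) \<Rightarrow> 'n) set) module" where
  "Ext1 A S T =
     quot_module (hom_space A (syzygy A S) T)
       ((\<lambda>g. restrict g (carrier (syzygy A S))) ` module_homs A (free_module A (carrier S)) T)"

section \<open>Lie algebras\<close>

record ('k, 'l) lie_ring = "('k, 'l) module" +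
  bracket :: "'l \<Rightarrow> 'l \<Rightarrow> 'l"

locale lie_algebra = module "scalars :: 'k::field ring" L
  for L :: "('k::field, 'l, 'z) lie_ring_scheme" (structure) +
  assumes bracket_closed:
      "\<lbrakk>x \<in> carrier L; y \<in> carrier L\<rbrakk> \<Longrightarrow> bracket L x y \<in> carrier L"
    and bracket_add_left:
      "\<lbrakk>x \<in> carrier L; y \<in> carrier L; z \<in> carrier L\<rbrakk>
        \<Longrightarrow> bracket L (x \<oplus> y) z = bracket L x z \<oplus> bracket L y z"
    and bracket_add_right:
      "\<lbrakk>x \<in> carrier L; y \<in> carrier L; z \<in> carrier L\<rbrakk>
        \<Longrightarrow> bracket L x (y \<oplus> z) = bracket L x y \<oplus> bracket L x z"
    and bracket_smult_left:
      "\<lbrakk>x \<in> carrier L; y \<in> carrier L\<rbrakk> \<Longrightarrow> bracket L (c \<odot> x) y = c \<odot> bracket L x y"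
    and bracket_smult_right:
      "\<lbrakk>x \<in> carrier L; y \<in> carrier L\<rbrakk> \<Longrightarrow> bracket L x (c \<odot> y) = c \<odot> bracket L x y"
    and bracket_self:
      "x \<in> carrier L \<Longrightarrow> bracket L x x = \<zero>"
    and jacobi:
      "\<lbrakk>x \<in> carrier L; y \<in> carrier L; z \<in> carrier L\<rbrakk>
        \<Longrightarrow> bracket L x (bracket L y z) \<oplus> bracket L y (bracket L z x)
              \<oplus> bracket L z (bracket L x y) = \<zero>"

primrec derived_series :: "('k::field, 'l, 'z) lie_ring_scheme \<Rightarrow> nat \<Rightarrow> 'l set" where
  "derived_series L 0 = carrier L"
| "derived_series L (Suc n) =
     lin_span L {bracket L x y | x y. x \<in> derived_series L n \<and> y \<in> derived_series L n}"

locale solvable_lie_algebra = lie_algebra +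
  assumes solvable: "\<exists>n. derived_series L n = {\<zero>}"

definition quot_lie :: "('k, 'l, 'z) lie_ring_scheme \<Rightarrow> 'l set \<Rightarrow> ('k, 'l set) lie_ring" where
  "quot_lie L J =
     \<lparr> carrier = a_rcosets\<^bsub>L\<^esub> J,
       monoid.mult = undefined,
       one = undefined,
       ring.zero = J,
       add = set_add L,
       module.smult = (\<lambda>c C. \<Union>x\<in>C. J +>\<^bsub>L\<^esub> (c \<odot>\<^bsub>L\<^esub> x)),
       bracket = (\<lambda>C D. \<Union>x\<in>C. \<Union>y\<in>D. J +>\<^bsub>L\<^esub> bracket L x y) \<rparr>"

section \<open>First Hochschild cohomology\<close>

definition derivations :: "('k, 'a, 'z) module_scheme \<Rightarrow> ('a \<Rightarrow> 'a) set" where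
  "derivations A =
     {d \<in> carrier A \<rightarrow>\<^sub>E carrier A.
        (\<forall>x\<in>carrier A. \<forall>y\<in>carrier A. d (x \<oplus>\<^bsub>A\<^esub> y) = d x \<oplus>\<^bsub>A\<^esub> d y) \<and>
        (\<forall>c. \<forall>x\<in>carrier A. d (c \<odot>\<^bsub>A\<^esub> x) = c \<odot>\<^bsub>A\<^esub> d x) \<and>
        (\<forall>x\<in>carrier A. \<forall>y\<in>carrier A.
            d (x \<otimes>\<^bsub>A\<^esub> y) = d x \<otimes>\<^bsub>A\<^esub> y \<oplus>\<^bsub>A\<^esub> x \<otimes>\<^bsub>A\<^esub> d y)}"

definition inner_derivations :: "('k, 'a, 'z) module_scheme \<Rightarrow> ('a \<Rightarrow> 'a) set" where
  "inner_derivations A =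
     {\<lambda>x\<in>carrier A. a \<otimes>\<^bsub>A\<^esub> x \<ominus>\<^bsub>A\<^esub> x \<otimes>\<^bsub>A\<^esub> a | a. a \<in> carrier A}"

definition der_lie :: "('k, 'a, 'z) module_scheme \<Rightarrow> ('k, 'a \<Rightarrow> 'a) lie_ring" where
  "der_lie A =
     \<lparr> carrier = derivations A,
       monoid.mult = undefined,
       one = undefined,
       ring.zero = (\<lambda>x\<in>carrier A. \<zero>\<^bsub>A\<^esub>),
       add = (\<lambda>d d'. \<lambda>x\<in>carrier A. d x \<oplus>\<^bsub>A\<^esub> d' x),
       module.smult = (\<lambda>c d. \<lambda>x\<in>carrier A. c \<odot>\<^bsub>A\<^esub> d x),
       bracket = (\<lambda>d d'. \<lambda>x\<in>carrier A. d (d' x) \<ominus>\<^bsub>A\<^esub> d' (d x)) \<rparr>"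

definition HH1 :: "('k, 'a, 'z) module_scheme \<Rightarrow> ('k, ('a \<Rightarrow> 'a) set) lie_ring" where
  "HH1 A = quot_lie (der_lie A) (inner_derivations A)"

section \<open>Parallel paths\<close>

text \<open>
  Below, \<open>r\<close> is a linear order on the paths of \<open>Q\<close>, with \<open>(p, q) \<in> r\<close> meaning that \<open>p\<close> is at most \<open>q\<close>.
\<close>

definition leading_path :: "('v, 'e) qpath rel \<Rightarrow> (('v, 'e) qpath \<Rightarrow> 'k::field) \<Rightarrow> ('v, 'e) qpath" where
  "leading_path r f = (THE p. f p \<noteq> 0 \<and> (\<forall>q. f q \<noteq> 0 \<longrightarrow> (q, p) \<in> r))"

text \<open>
  For an admissible ideal, the classes of these paths form a basis of the bound quiver algebra
  whatever the linear order \<open>r\<close> is: all sufficiently long paths lie in the ideal, so reduction takes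
  place among finitely many paths.  All vertices and arrows are included, since every nonzero element
  of the ideal is a combination of paths of length at least 2.
\<close>

definition basis_paths ::
    "('v, 'e) pre_digraph \<Rightarrow> (('v, 'e) qpath \<Rightarrow> 'k::field) set \<Rightarrow> ('v, 'e) qpath rel
       \<Rightarrow> ('v, 'e) qpath set" where
  "basis_paths Q I r =
     {p \<in> paths Q. \<not> (\<exists>f\<in>I. f \<noteq> (\<lambda>_. 0) \<and> leading_path r f = p)}"

text \<open>The pair \<open>(a, b)\<close> stands for the linear map sending the arrow \<open>a\<close> to \<open>b\<close> and the others to 0.\<close>

definition parallel_pairs ::
    "('v, 'e) pre_digraph \<Rightarrow> (('v, 'e) qpath \<Rightarrow> 'k::field) set \<Rightarrow> ('v, 'e) qpath rel
       \<Rightarrow> ('e \<times> ('v, 'e) qpath) set" where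
  "parallel_pairs Q I r =
     {(a, b). a \<in> arcs Q \<and> b \<in> basis_paths Q I r \<and>
              fst b = tail Q a \<and> snd (snd b) = head Q a}"

text \<open>
  A linear combination of parallel pairs is given by its coefficient function \<open>x\<close>; the function
  \<open>\<lambda>b. x (a, b)\<close> is then the linear combination of paths to which it sends the arrow \<open>a\<close>, viewed as
  an element of the path algebra.
\<close>

definition ker_delta1 ::
    "('v, 'e) pre_digraph \<Rightarrow> (('v, 'e) qpath \<Rightarrow> 'k::field) set \<Rightarrow> ('v, 'e) qpath rel
       \<Rightarrow> ('e \<times> ('v, 'e) qpath \<Rightarrow> 'k) set" where
  "ker_delta1 Q I r =
     {x. finite {ab. x ab \<noteq> 0} \<and> {ab. x ab \<noteq> 0} \<subseteq> parallel_pairs Q I r \<and>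
         (\<exists>d\<in>derivations (bound_quiver_algebra Q I).
            (\<forall>v\<in>verts Q. d (bqa_class Q I (path_elem (vertex_path v)))
                           = \<zero>\<^bsub>bound_quiver_algebra Q I\<^esub>) \<and>
            (\<forall>a\<in>arcs Q. d (bqa_class Q I (path_elem (arrow_path Q a)))
                          = bqa_class Q I (\<lambda>b. x (a, b))))}"

definition Sigma0 ::
    "('v, 'e) pre_digraph \<Rightarrow> (('v, 'e) qpath \<Rightarrow> 'k::field) set \<Rightarrow> ('v, 'e) qpath rel
       \<Rightarrow> ('e \<times> ('v, 'e) qpath) set" where
  "Sigma0 Q I r =
     {(a, vertex_path v) | a v.
        a \<in> arcs Q \<and> tail Q a = v \<and> head Q a = v \<and>
        (\<exists>x\<in>ker_delta1 Q I r. x (a, vertex_path v) \<noteq> 0)}"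

end

(*
  Modulo an inner derivation, every derivation d of A kills the vertices, and then maps each arrow
  a : u -> v into e_u A e_v.  Emptiness of Sigma0 forces d(J) <= J, where J is the radical.  Two
  parallel arrows would give a two-dimensional space of extensions of one-dimensional simple modules,
  so e_u J e_v is spanned by a modulo J^2 and d acts diagonally on J/J^2.  Hence, with F_k the space of
  derivations killing the vertices and mapping J to J^(k+1), one has [F_0, F_0] <= F_1 and
  [F_k, F_l] <= F_(k+l); as J is nilpotent, F_k = 0 for large k.
*)
theory Submission
  imports Defs
begin

text \<open>\<open>Sigma0\<close> speaks of coefficients of basis paths, but a class in
  \<open>A\<close> has coefficients only after a normal form is chosen. The order \<open>r\<close>
  is merely linear and may be neither well-founded nor compatible with composition; reduction
  terminates because admissibility puts all long paths into \<open>I\<close>, which leaves finitely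
  many short ones. The bound on Ext is used in contrapositive form, directly on the free
  presentation: the coefficients of two parallel arrows are cocycles for the characters at the two
  endpoints, and the class of a single homomorphism cannot span both of the induced classes. The
  additive behaviour of the filtration under brackets gains nothing in degree 0. The diagonal action
  is needed exactly there, since diagonal actions commute; from degree 1 on, n + n >= n + 1 gives
  progress at every step.\<close>

section \<open>Vector spaces and subspaces over \<open>scalars\<close>\<close>

lemma scalars_simps [simp]:
  "carrier scalars = UNIV" "x \<otimes>\<^bsub>scalars\<^esub> y = x * y" "\<one>\<^bsub>scalars\<^esub> = 1"
  "\<zero>\<^bsub>scalars\<^esub> = 0" "x \<oplus>\<^bsub>scalars\<^esub> y = x + y"
  by (simp_all add: ring_of_type_algebra_def)

lemma module_scalarsI:
  fixes V :: "('k::field, 'b, 'z) module_scheme" (structure)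
  assumes "abelian_group V"
    and "\<And>c x. x \<in> carrier V \<Longrightarrow> c \<odot> x \<in> carrier V"
    and "\<And>a b x. x \<in> carrier V \<Longrightarrow> (a + b) \<odot> x = a \<odot> x \<oplus> b \<odot> x"
    and "\<And>a x y. \<lbrakk>x \<in> carrier V; y \<in> carrier V\<rbrakk> \<Longrightarrow> a \<odot> (x \<oplus> y) = a \<odot> x \<oplus> a \<odot> y"
    and "\<And>a b x. x \<in> carrier V \<Longrightarrow> (a * b) \<odot> x = a \<odot> (b \<odot> x)"
    and "\<And>x. x \<in> carrier V \<Longrightarrow> 1 \<odot> x = x"
  shows "module scalars V"
  using assms by (intro moduleI) (auto simp: cring_from_type_algebra)

text \<open>An additive inverse is the multiple by -1, so closure under scalars already yields the
  negation that \<open>submodule\<close> asks for.\<close>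

lemma submodule_scalarsI:
  fixes V :: "('k::field, 'b, 'z) module_scheme" (structure)
  assumes V: "module scalars V" and sub: "H \<subseteq> carrier V" and zero: "\<zero> \<in> H"
    and add: "\<And>a b. \<lbrakk>a \<in> H; b \<in> H\<rbrakk> \<Longrightarrow> a \<oplus> b \<in> H"
    and smult: "\<And>c a. a \<in> H \<Longrightarrow> c \<odot> a \<in> H"
  shows "submodule H scalars V"
proof -
  interpret V: module scalars V by fact
  have "\<ominus> a \<in> H" if "a \<in> H" for a
  proof -
    have "(- 1) \<odot> a \<oplus> a = ((- 1) + 1) \<odot> a"
      using that sub V.smult_l_distr[of "- 1" 1 a] V.smult_one[of a] by auto
    also have "\<dots> = \<zero>"
      using that sub V.smult_l_null[of a] by auto
    finally have "\<ominus> a = (- 1) \<odot> a"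
      using that sub smult[of a "- 1"] V.M.minus_equality by blast
    then show ?thesis using smult that by simp
  qed
  then show ?thesis
    using assms by (intro V.submoduleI) auto
qed

text \<open>The base \<open>R\<close> is left general because the same facts serve subspaces over
  the field and, in the proof of simplicity, submodules over an algebra.\<close>

lemma submoduleD:
  assumes "submodule H R M" "abelian_group M"
  shows "H \<subseteq> carrier M" "\<zero>\<^bsub>M\<^esub> \<in> H" "\<And>a b. \<lbrakk>a \<in> H; b \<in> H\<rbrakk> \<Longrightarrow> a \<oplus>\<^bsub>M\<^esub> b \<in> H"
    "\<And>c a. \<lbrakk>c \<in> carrier R; a \<in> H\<rbrakk> \<Longrightarrow> c \<odot>\<^bsub>M\<^esub> a \<in> H"
proof -
  interpret submodule H R M by fact
  show "H \<subseteq> carrier M" "\<zero>\<^bsub>M\<^esub> \<in> H"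
    using subset one_closed by simp_all
  show "\<And>a b. \<lbrakk>a \<in> H; b \<in> H\<rbrakk> \<Longrightarrow> a \<oplus>\<^bsub>M\<^esub> b \<in> H"
    using m_closed by simp
  show "\<And>c a. \<lbrakk>c \<in> carrier R; a \<in> H\<rbrakk> \<Longrightarrow> c \<odot>\<^bsub>M\<^esub> a \<in> H"
    by (rule smult_closed)
qed

lemma submodule_imp_abelian_subgroup:
  assumes "module scalars V" "submodule W scalars V"
  shows "abelian_subgroup W V"
proof -
  interpret V: module scalars V by fact
  show ?thesis
    using assms(2) V.M.abelian_group_axioms
    by (intro abelian_subgroupI3 additive_subgroup.intro) (auto simp: submodule_def)
qed

section \<open>Quotient modules\<close>

text \<open>Quotient records define scalar multiplication as a union over all representatives of a
  coset. Two representatives differ by some \<open>w\<close> in \<open>W\<close>, and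
  \<open>c \<odot> w\<close> stays in \<open>W\<close>, so every member of the union is the same
  coset.\<close>

lemma smult_coset:
  fixes V :: "('k::field, 'b, 'z) module_scheme" (structure)
  assumes V: "module scalars V" and W: "submodule W scalars V" and x: "x \<in> carrier V"
  shows "(\<Union>y\<in>W +> x. W +> (c \<odot> y)) = W +> (c \<odot> x)"
proof -
  interpret V: module scalars V by fact
  interpret W: abelian_subgroup W V
    using V W by (rule submodule_imp_abelian_subgroup)
  have "W +> (c \<odot> y) = W +> (c \<odot> x)" if y: "y \<in> W +> x" for y
  proof -
    obtain w where w: "w \<in> W" "y = w \<oplus> x"
      using y by (auto simp: a_r_coset_def r_coset_def)
    have wc: "w \<in> carrier V" using w(1) by (rule W.a_Hcarr)
    have "c \<odot> y = c \<odot> w \<oplus> c \<odot> x"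
      using w wc x V.smult_r_distr[of c w x] by simp
    moreover have "c \<odot> w \<in> W"
      using submoduleD(4)[OF W V.M.abelian_group_axioms] w by simp
    ultimately have "c \<odot> y \<in> W +> (c \<odot> x)"
      by (auto simp: a_r_coset_def r_coset_def)
    then show ?thesis
      using V.M.a_repr_independence[of "c \<odot> y" W "c \<odot> x"] x W.a_subgroup
        V.smult_closed[of c x] by simp
  qed
  moreover have "x \<in> W +> x" using x by (rule W.a_rcos_self)
  ultimately show ?thesis by blast
qed

text \<open>Only the carrier, zero, addition and scalar action of \<open>V'\<close> are prescribed,
  so one locale covers \<open>Ext1\<close>, \<open>bound_quiver_algebra\<close> and
  \<open>quot_lie\<close>, whatever further fields these records carry.\<close>

locale quotient_vector_space =
  fixes V :: "('k::field, 'b, 'z) module_scheme" (structure)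
    and W and V' :: "('k, 'b set, 'y) module_scheme"
  assumes module: "module scalars V"
    and sub: "submodule W scalars V"
    and carrier_eq: "carrier V' = a_rcosets W"
    and zero_eq: "\<zero>\<^bsub>V'\<^esub> = W"
    and add_eq: "add V' = set_add V"
    and smult_eq: "module.smult V' = (\<lambda>c C. \<Union>x\<in>C. W +> (c \<odot> x))"
begin

sublocale V: module scalars V by (rule module)

sublocale W: abelian_subgroup W V
  using module sub by (rule submodule_imp_abelian_subgroup)

lemma carrier_quotient: "carrier V' = (\<lambda>x. W +> x) ` carrier V"
  unfolding carrier_eq by (auto simp: A_RCOSETS_defs a_r_coset_def)

lemma add_quotient:
  "\<lbrakk>x \<in> carrier V; y \<in> carrier V\<rbrakk> \<Longrightarrow> (W +> x) \<oplus>\<^bsub>V'\<^esub> (W +> y) = W +> (x \<oplus> y)"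
  unfolding add_eq by (rule W.a_rcos_sum)

lemma smult_quotient:
  "x \<in> carrier V \<Longrightarrow> c \<odot>\<^bsub>V'\<^esub> (W +> x) = W +> (c \<odot> x)"
  unfolding smult_eq by (rule smult_coset[OF module sub])

lemma zero_quotient: "\<zero>\<^bsub>V'\<^esub> = W +> \<zero>"
  unfolding zero_eq using V.M.a_coset_add_zero[OF W.a_subset] by simp

lemma coset_eq_iff:
  assumes "x \<in> carrier V" "y \<in> carrier V"
  shows "W +> x = W +> y \<longleftrightarrow> x \<ominus> y \<in> W"
proof
  assume "W +> x = W +> y"
  then show "x \<ominus> y \<in> W"
    using assms W.a_rcos_self[of x] W.a_rcos_module_imp[of y x] by (simp add: a_minus_def)
next
  assume "x \<ominus> y \<in> W"
  then have "x \<in> W +> y"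
    using assms W.a_rcos_module_rev[of y x] by (simp add: a_minus_def)
  then show "W +> x = W +> y"
    using V.M.a_repr_independence[of x W y] assms W.a_subgroup by simp
qed

lemma coset_eq_zero_iff:
  "x \<in> carrier V \<Longrightarrow> W +> x = \<zero>\<^bsub>V'\<^esub> \<longleftrightarrow> x \<in> W"
  unfolding zero_quotient using coset_eq_iff[of x \<zero>] V.M.minus_equality[of \<zero> \<zero>] by (simp add: a_minus_def)

lemma abelian_group_quotient: "abelian_group V'"
proof (rule abelian_groupI)
  note [simp] = W.rcosets_add_eq[folded zero_eq add_eq carrier_eq]
  show "\<zero>\<^bsub>V'\<^esub> \<in> carrier V'"
    unfolding zero_eq carrier_eq by (rule W.a_subgroup_in_rcosets)
  fix x assume x: "x \<in> carrier V'"
  show "\<zero>\<^bsub>V'\<^esub> \<oplus>\<^bsub>V'\<^esub> x = x" using x by simp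
  show "\<exists>y\<in>carrier V'. y \<oplus>\<^bsub>V'\<^esub> x = \<zero>\<^bsub>V'\<^esub>"
  proof -
    obtain u where u: "u \<in> carrier V" "x = W +> u" using x by (auto simp: carrier_quotient)
    then have "(W +> (\<ominus> u)) \<oplus>\<^bsub>V'\<^esub> x = \<zero>\<^bsub>V'\<^esub>"
      by (simp add: add_quotient zero_quotient V.M.l_neg)
    then show ?thesis using u by (auto simp: carrier_quotient)
  qed
  fix y assume y: "y \<in> carrier V'"
  show "x \<oplus>\<^bsub>V'\<^esub> y \<in> carrier V'" "x \<oplus>\<^bsub>V'\<^esub> y = y \<oplus>\<^bsub>V'\<^esub> x"
    using x y by (auto simp: carrier_quotient add_quotient V.M.a_comm)
  fix z assume z: "z \<in> carrier V'"
  show "x \<oplus>\<^bsub>V'\<^esub> y \<oplus>\<^bsub>V'\<^esub> z = x \<oplus>\<^bsub>V'\<^esub> (y \<oplus>\<^bsub>V'\<^esub> z)"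
    using x y z by (auto simp: carrier_quotient add_quotient V.M.a_assoc)
qed

lemma module_quotient: "module scalars V'"
proof (intro module_scalarsI abelian_group_quotient)
  fix c x assume "x \<in> carrier V'"
  then show "c \<odot>\<^bsub>V'\<^esub> x \<in> carrier V'"
    unfolding carrier_quotient by (auto simp: smult_quotient)
next
  fix a b x assume "x \<in> carrier V'"
  then obtain y where y: "y \<in> carrier V" "x = W +> y" by (auto simp: carrier_quotient)
  then show "(a + b) \<odot>\<^bsub>V'\<^esub> x = a \<odot>\<^bsub>V'\<^esub> x \<oplus>\<^bsub>V'\<^esub> b \<odot>\<^bsub>V'\<^esub> x"
    using V.smult_l_distr[of a b y] by (simp add: smult_quotient add_quotient)
  show "(a * b) \<odot>\<^bsub>V'\<^esub> x = a \<odot>\<^bsub>V'\<^esub> (b \<odot>\<^bsub>V'\<^esub> x)"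
    using y V.smult_assoc1[of a b y] by (simp add: smult_quotient)
next
  fix a x y assume "x \<in> carrier V'" "y \<in> carrier V'"
  then obtain u v where "u \<in> carrier V" "x = W +> u" "v \<in> carrier V" "y = W +> v"
    by (auto simp: carrier_quotient)
  then show "a \<odot>\<^bsub>V'\<^esub> (x \<oplus>\<^bsub>V'\<^esub> y) = a \<odot>\<^bsub>V'\<^esub> x \<oplus>\<^bsub>V'\<^esub> a \<odot>\<^bsub>V'\<^esub> y"
    using V.smult_r_distr[of a u v] by (simp add: smult_quotient add_quotient)
next
  fix x assume "x \<in> carrier V'"
  then show "1 \<odot>\<^bsub>V'\<^esub> x = x"
    using V.smult_one by (auto simp: carrier_quotient smult_quotient)
qed

lemma submodule_quotient:
  assumes H: "submodule H scalars V"
  shows "submodule ((\<lambda>x. W +> x) ` H) scalars V'"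
proof (rule submodule_scalarsI[OF module_quotient])
  note H = submoduleD[OF H V.M.abelian_group_axioms]
  show "(\<lambda>x. W +> x) ` H \<subseteq> carrier V'"
    using H(1) by (auto simp: carrier_quotient)
  show "\<zero>\<^bsub>V'\<^esub> \<in> (\<lambda>x. W +> x) ` H"
    using H(2) by (auto simp: zero_quotient)
  show "a \<oplus>\<^bsub>V'\<^esub> b \<in> (\<lambda>x. W +> x) ` H"
    if "a \<in> (\<lambda>x. W +> x) ` H" "b \<in> (\<lambda>x. W +> x) ` H" for a b
    using that H(1,3) by (auto simp: add_quotient subset_iff)
  show "c \<odot>\<^bsub>V'\<^esub> a \<in> (\<lambda>x. W +> x) ` H" if "a \<in> (\<lambda>x. W +> x) ` H" for c a
    using that H(1,4) by (auto simp: smult_quotient subset_iff)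
qed

end

lemma lin_span_least:
  "\<lbrakk>submodule W scalars V; B \<subseteq> W\<rbrakk> \<Longrightarrow> lin_span V B \<subseteq> W"
  unfolding lin_span_def by auto

lemma zero_in_lin_span: "abelian_group V \<Longrightarrow> \<zero>\<^bsub>V\<^esub> \<in> lin_span V B"
  unfolding lin_span_def using submoduleD(2) by blast

section \<open>Lie algebras\<close>

text \<open>Each term of the derived series is the least subspace containing the brackets of the
  previous one, so a chain of subspaces \<open>F n\<close> that absorbs brackets in this way
  dominates the series.\<close>

lemma (in lie_algebra) solvableI:
  assumes sub: "\<And>n. submodule (F n) scalars L"
    and top: "carrier L \<subseteq> F 0"
    and step: "\<And>n x y. \<lbrakk>x \<in> F n; y \<in> F n\<rbrakk> \<Longrightarrow> bracket L x y \<in> F (Suc n)"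
    and bot: "F N \<subseteq> {\<zero>}"
  shows "solvable_lie_algebra L"
proof
  have "derived_series L n \<subseteq> F n" for n
  proof (induction n)
    case 0
    then show ?case using top by simp
  next
    case (Suc n)
    then have "{bracket L x y |x y. x \<in> derived_series L n \<and> y \<in> derived_series L n} \<subseteq> F (Suc n)"
      using step[of _ n] by blast
    then show ?case
      unfolding derived_series.simps by (rule lin_span_least[OF sub])
  qed
  \<comment> \<open>The upper bound alone would allow an empty set; a span always contains
    zero.\<close>
  moreover have "\<zero> \<in> derived_series L n" for n
    by (cases n) (auto intro: zero_in_lin_span M.abelian_group_axioms)
  ultimately have "derived_series L N = {\<zero>}" using bot by blast
  then show "\<exists>n. derived_series L n = {\<zero>}" ..
qed

section \<open>Lie ideals and quotient Lie algebras\<close>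

text \<open>Only brackets with the ideal element on the right are required; the other side follows
  by antisymmetry in \<open>bracket_ideal_left\<close>.\<close>

definition lie_ideal :: "'l set \<Rightarrow> ('k::field, 'l, 'z) lie_ring_scheme \<Rightarrow> bool" where
  "lie_ideal J L \<longleftrightarrow> submodule J scalars L \<and>
     (\<forall>x\<in>carrier L. \<forall>y\<in>J. bracket L x y \<in> J)"

locale quotient_lie_algebra = lie_algebra L for L (structure) +
  fixes J
  assumes ideal: "lie_ideal J L"
begin

sublocale Q: quotient_vector_space L J "quot_lie L J"
  using ideal module_axioms
  by (intro quotient_vector_space.intro) (simp_all add: lie_ideal_def quot_lie_def)

text \<open>Polarisation: the alternating law is applied to \<open>x \<oplus> y\<close>.\<close>

lemma bracket_swap:
  assumes x: "x \<in> carrier L" and y: "y \<in> carrier L"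
  shows "bracket L x y = \<ominus> bracket L y x"
proof -
  have "\<zero> = bracket L (x \<oplus> y) (x \<oplus> y)"
    using x y by (simp add: bracket_self)
  also have "\<dots> = bracket L x y \<oplus> bracket L y x"
    using x y bracket_self[of x] bracket_self[of y]
    by (simp add: bracket_add_left bracket_add_right bracket_closed M.a_comm)
  finally show ?thesis
    using x y M.minus_equality[of "bracket L x y" "bracket L y x"] by (simp add: bracket_closed)
qed

lemma bracket_ideal_left: "\<lbrakk>x \<in> carrier L; y \<in> J\<rbrakk> \<Longrightarrow> bracket L y x \<in> J"
  using bracket_swap[of y x] ideal Q.W.a_Hcarr Q.W.a_inv_closed by (auto simp: lie_ideal_def)

text \<open>As with scalars, the bracket of cosets is a union over representatives. Expanding the
  bracket of \<open>s \<oplus> x\<close> and \<open>t \<oplus> y\<close> gives the bracket of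
  \<open>x\<close> and \<open>y\<close> plus three terms involving \<open>s\<close> or
  \<open>t\<close>, all of them in \<open>J\<close>.\<close>

lemma bracket_quotient:
  assumes x: "x \<in> carrier L" and y: "y \<in> carrier L"
  shows "bracket (quot_lie L J) (J +> x) (J +> y) = J +> bracket L x y"
proof -
  have eq: "J +> bracket L u v = J +> bracket L x y" if u: "u \<in> J +> x" and v: "v \<in> J +> y" for u v
  proof -
    obtain s t where st: "s \<in> J" "u = s \<oplus> x" "t \<in> J" "v = t \<oplus> y"
      using u v by (auto simp: a_r_coset_def r_coset_def)
    have c: "s \<in> carrier L" "t \<in> carrier L" using st by (auto intro: Q.W.a_Hcarr)
    have "bracket L u v =
        (bracket L s t \<oplus> bracket L s y \<oplus> bracket L x t) \<oplus> bracket L x y"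
      using c x y unfolding st
      by (simp add: bracket_add_left bracket_add_right bracket_closed M.a_ac)
    moreover have "bracket L s t \<oplus> bracket L s y \<oplus> bracket L x t \<in> J"
      using ideal st c x y bracket_ideal_left[of y s] by (auto simp: lie_ideal_def intro!: Q.W.a_closed)
    ultimately have "bracket L u v \<in> J +> bracket L x y"
      by (auto simp: a_r_coset_def r_coset_def)
    then show ?thesis
      using M.a_repr_independence[of "bracket L u v" J "bracket L x y"] x y Q.W.a_subgroup
        bracket_closed[of x y] by simp
  qed
  have "bracket (quot_lie L J) (J +> x) (J +> y) = (\<Union>u\<in>J +> x. \<Union>v\<in>J +> y. J +> bracket L u v)"
    by (simp add: quot_lie_def)
  also have "\<dots> = (\<Union>u\<in>J +> x. \<Union>v\<in>J +> y. J +> bracket L x y)"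
    by (intro SUP_cong refl eq)
  also have "\<dots> = J +> bracket L x y"
    using Q.W.a_rcos_self[OF x] Q.W.a_rcos_self[OF y] by blast
  finally show ?thesis .
qed

lemma lie_algebra_quotient: "lie_algebra (quot_lie L J)"
proof (intro lie_algebra.intro lie_algebra_axioms.intro Q.module_quotient)
  note [simp] = Q.add_quotient Q.smult_quotient bracket_quotient bracket_closed bracket_add_left
    bracket_add_right bracket_smult_left bracket_smult_right bracket_self
  note c = Q.carrier_quotient
  fix x y z assume x: "x \<in> carrier (quot_lie L J)" and y: "y \<in> carrier (quot_lie L J)"
  from x y show "bracket (quot_lie L J) x y \<in> carrier (quot_lie L J)"
    by (auto simp: c)
  from x y show "bracket (quot_lie L J) (k \<odot>\<^bsub>quot_lie L J\<^esub> x) y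
      = k \<odot>\<^bsub>quot_lie L J\<^esub> bracket (quot_lie L J) x y" for k
    using smult_closed[of k] by (auto simp: c)
  from x y show "bracket (quot_lie L J) x (k \<odot>\<^bsub>quot_lie L J\<^esub> y)
      = k \<odot>\<^bsub>quot_lie L J\<^esub> bracket (quot_lie L J) x y" for k
    using smult_closed[of k] by (auto simp: c)
  from x show "bracket (quot_lie L J) x x = \<zero>\<^bsub>quot_lie L J\<^esub>"
    by (auto simp: c Q.zero_quotient)
  assume z: "z \<in> carrier (quot_lie L J)"
  from x y z show "bracket (quot_lie L J) (x \<oplus>\<^bsub>quot_lie L J\<^esub> y) z
      = bracket (quot_lie L J) x z \<oplus>\<^bsub>quot_lie L J\<^esub> bracket (quot_lie L J) y z"
    by (auto simp: c)
  from x y z show "bracket (quot_lie L J) x (y \<oplus>\<^bsub>quot_lie L J\<^esub> z)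
      = bracket (quot_lie L J) x y \<oplus>\<^bsub>quot_lie L J\<^esub> bracket (quot_lie L J) x z"
    by (auto simp: c)
  from x y z show "bracket (quot_lie L J) x (bracket (quot_lie L J) y z)
      \<oplus>\<^bsub>quot_lie L J\<^esub> bracket (quot_lie L J) y (bracket (quot_lie L J) z x)
      \<oplus>\<^bsub>quot_lie L J\<^esub> bracket (quot_lie L J) z (bracket (quot_lie L J) x y)
      = \<zero>\<^bsub>quot_lie L J\<^esub>"
    using jacobi by (auto simp: c Q.zero_quotient)
qed

end

section \<open>Derivations of an algebra\<close>

locale kalgebra = ring A + V: module "scalars :: 'k::field ring" A
  for A :: "('k::field, 'a, 'z) module_scheme" (structure) +
  assumes smult_mult_left:
      "\<lbrakk>x \<in> carrier A; y \<in> carrier A\<rbrakk> \<Longrightarrow> (c \<odot> x) \<otimes> y = c \<odot> (x \<otimes> y)"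
    and smult_mult_right:
      "\<lbrakk>x \<in> carrier A; y \<in> carrier A\<rbrakk> \<Longrightarrow> x \<otimes> (c \<odot> y) = c \<odot> (x \<otimes> y)"
begin

lemma smult_closed' [simp, intro]: "x \<in> carrier A \<Longrightarrow> c \<odot> x \<in> carrier A"
  by (rule V.smult_closed) simp

lemma smult_distrib_left:
  "\<lbrakk>x \<in> carrier A; y \<in> carrier A\<rbrakk> \<Longrightarrow> c \<odot> (x \<oplus> y) = c \<odot> x \<oplus> c \<odot> y"
  using V.smult_r_distr by simp

lemma smult_distrib_right:
  "x \<in> carrier A \<Longrightarrow> (c + c') \<odot> x = c \<odot> x \<oplus> c' \<odot> x"
  using V.smult_l_distr by simp

lemma smult_smult: "x \<in> carrier A \<Longrightarrow> c \<odot> (c' \<odot> x) = (c * c') \<odot> x"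
  using V.smult_assoc1 by simp

lemma smult_1: "x \<in> carrier A \<Longrightarrow> 1 \<odot> x = x"
  using V.smult_one by simp

lemma smult_0: "x \<in> carrier A \<Longrightarrow> 0 \<odot> x = \<zero>"
  using V.smult_l_null by simp

lemma smult_zero: "c \<odot> \<zero> = \<zero>"
  using V.smult_r_null by simp

lemma smult_minus: "x \<in> carrier A \<Longrightarrow> c \<odot> (\<ominus> x) = \<ominus> (c \<odot> x)"
  using V.smult_r_minus by simp

lemma smult_diff:
  "\<lbrakk>x \<in> carrier A; y \<in> carrier A\<rbrakk> \<Longrightarrow> c \<odot> (x \<ominus> y) = c \<odot> x \<ominus> c \<odot> y"
  by (simp add: a_minus_def smult_distrib_left smult_minus)

lemma derivationI:
  assumes "d \<in> carrier A \<rightarrow>\<^sub>E carrier A"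
    and "\<And>x y. \<lbrakk>x \<in> carrier A; y \<in> carrier A\<rbrakk> \<Longrightarrow> d (x \<oplus> y) = d x \<oplus> d y"
    and "\<And>c x. x \<in> carrier A \<Longrightarrow> d (c \<odot> x) = c \<odot> d x"
    and "\<And>x y. \<lbrakk>x \<in> carrier A; y \<in> carrier A\<rbrakk> \<Longrightarrow> d (x \<otimes> y) = d x \<otimes> y \<oplus> x \<otimes> d y"
  shows "d \<in> derivations A"
  using assms by (simp add: derivations_def)

context
  fixes d assumes d: "d \<in> derivations A"
begin

lemma derivation_PiE: "d \<in> carrier A \<rightarrow>\<^sub>E carrier A"
  using d by (simp add: derivations_def)

lemma derivation_closed: "x \<in> carrier A \<Longrightarrow> d x \<in> carrier A"
  using derivation_PiE by auto

lemma derivation_add: "\<lbrakk>x \<in> carrier A; y \<in> carrier A\<rbrakk> \<Longrightarrow> d (x \<oplus> y) = d x \<oplus> d y"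
  using d by (simp add: derivations_def)

lemma derivation_smult: "x \<in> carrier A \<Longrightarrow> d (c \<odot> x) = c \<odot> d x"
  using d by (simp add: derivations_def)

lemma derivation_mult:
  "\<lbrakk>x \<in> carrier A; y \<in> carrier A\<rbrakk> \<Longrightarrow> d (x \<otimes> y) = d x \<otimes> y \<oplus> x \<otimes> d y"
  using d by (simp add: derivations_def)

lemma derivation_zero: "d \<zero> = \<zero>"
  using derivation_smult[of \<zero> 0] by (simp add: smult_0 derivation_closed)

lemma derivation_minus: "x \<in> carrier A \<Longrightarrow> d (\<ominus> x) = \<ominus> d x"
  using derivation_add[of "\<ominus> x" x] minus_equality[of "d (\<ominus> x)" "d x"]
  by (simp add: l_neg derivation_zero derivation_closed)

lemma derivation_diff:
  "\<lbrakk>x \<in> carrier A; y \<in> carrier A\<rbrakk> \<Longrightarrow> d (x \<ominus> y) = d x \<ominus> d y"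
  by (simp add: a_minus_def derivation_add derivation_minus)

end

lemma derivation_eqI:
  assumes "d \<in> derivations A" "d' \<in> derivations A" "\<And>x. x \<in> carrier A \<Longrightarrow> d x = d' x"
  shows "d = d'"
  using assms derivation_PiE by (meson PiE_ext)

lemmas der_simps = derivation_closed derivation_add derivation_smult derivation_mult
  derivation_zero derivation_minus

lemma der_lie_simps [simp]:
  "carrier (der_lie A) = derivations A"
  "\<zero>\<^bsub>der_lie A\<^esub> = (\<lambda>x\<in>carrier A. \<zero>)"
  "d \<oplus>\<^bsub>der_lie A\<^esub> d' = (\<lambda>x\<in>carrier A. d x \<oplus> d' x)"
  "c \<odot>\<^bsub>der_lie A\<^esub> d = (\<lambda>x\<in>carrier A. c \<odot> d x)"
  "bracket (der_lie A) d d' = (\<lambda>x\<in>carrier A. d (d' x) \<ominus> d' (d x))"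
  by (simp_all add: der_lie_def)

lemma zero_derivation: "(\<lambda>x\<in>carrier A. \<zero>) \<in> derivations A"
  by (rule derivationI) (auto simp: smult_zero)

lemma add_derivation:
  assumes "d \<in> derivations A" "d' \<in> derivations A"
  shows "(\<lambda>x\<in>carrier A. d x \<oplus> d' x) \<in> derivations A"
  using assms
  by (intro derivationI) (auto simp: der_simps smult_distrib_left l_distr r_distr a_ac)

lemma smult_derivation:
  assumes "d \<in> derivations A"
  shows "(\<lambda>x\<in>carrier A. c \<odot> d x) \<in> derivations A"
  using assms
  by (intro derivationI)
    (auto simp: der_simps smult_distrib_left smult_mult_left smult_mult_right smult_smult mult.commute)

lemma add_diff_add:
  "\<lbrakk>a \<in> carrier A; b \<in> carrier A; c \<in> carrier A; e \<in> carrier A\<rbrakk>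
    \<Longrightarrow> (a \<oplus> b) \<ominus> (c \<oplus> e) = (a \<ominus> c) \<oplus> (b \<ominus> e)"
  by algebra

text \<open>The Leibniz rule for a commutator, with the values of the derivations abstracted to ring
  elements: \<open>dx'\<close> stands for d'(x), \<open>ddx\<close> for d(d'(x)) and
  \<open>ddx'\<close> for d'(d(x)). The mixed products \<open>dx' \<otimes> dy\<close> and
  \<open>dx \<otimes> dy'\<close> occur in both composites and cancel.\<close>

lemma leibniz_bracket:
  assumes "x \<in> carrier A" "y \<in> carrier A" "dx \<in> carrier A" "dy \<in> carrier A"
    "dx' \<in> carrier A" "dy' \<in> carrier A" "ddx \<in> carrier A" "ddy \<in> carrier A"
    "ddx' \<in> carrier A" "ddy' \<in> carrier A"
  shows "(ddx \<otimes> y \<oplus> dx' \<otimes> dy \<oplus> (dx \<otimes> dy' \<oplus> x \<otimes> ddy))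
      \<ominus> (ddx' \<otimes> y \<oplus> dx \<otimes> dy' \<oplus> (dx' \<otimes> dy \<oplus> x \<otimes> ddy'))
    = (ddx \<ominus> ddx') \<otimes> y \<oplus> x \<otimes> (ddy \<ominus> ddy')"
  using assms by algebra

lemma bracket_derivation:
  assumes d: "d \<in> derivations A" and d': "d' \<in> derivations A"
  shows "(\<lambda>x\<in>carrier A. d (d' x) \<ominus> d' (d x)) \<in> derivations A"
proof (rule derivationI)
  note [simp] = der_simps[OF d] der_simps[OF d']
  show "(\<lambda>x\<in>carrier A. d (d' x) \<ominus> d' (d x)) \<in> carrier A \<rightarrow>\<^sub>E carrier A"
    by auto
  fix c x assume x: "x \<in> carrier A"
  then show "(\<lambda>x\<in>carrier A. d (d' x) \<ominus> d' (d x)) (c \<odot> x)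
      = c \<odot> (\<lambda>x\<in>carrier A. d (d' x) \<ominus> d' (d x)) x"
    by (simp add: smult_diff)
  fix y assume y: "y \<in> carrier A"
  have c: "d x \<in> carrier A" "d y \<in> carrier A" "d' x \<in> carrier A" "d' y \<in> carrier A"
    "d (d' x) \<in> carrier A" "d (d' y) \<in> carrier A" "d' (d x) \<in> carrier A" "d' (d y) \<in> carrier A"
    using x y by simp_all
  show "(\<lambda>x\<in>carrier A. d (d' x) \<ominus> d' (d x)) (x \<oplus> y)
      = (\<lambda>x\<in>carrier A. d (d' x) \<ominus> d' (d x)) x \<oplus> (\<lambda>x\<in>carrier A. d (d' x) \<ominus> d' (d x)) y"
    using x y by (simp add: add_diff_add)
  show "(\<lambda>x\<in>carrier A. d (d' x) \<ominus> d' (d x)) (x \<otimes> y)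
      = (\<lambda>x\<in>carrier A. d (d' x) \<ominus> d' (d x)) x \<otimes> y \<oplus> x \<otimes> (\<lambda>x\<in>carrier A. d (d' x) \<ominus> d' (d x)) y"
    using x y leibniz_bracket[OF x y c] by simp
qed

lemma module_der_lie: "module scalars (der_lie A)"
proof (intro module_scalarsI abelian_groupI)
  fix d assume d: "d \<in> carrier (der_lie A)"
  then have d': "d \<in> derivations A" by simp
  show "\<zero>\<^bsub>der_lie A\<^esub> \<oplus>\<^bsub>der_lie A\<^esub> d = d" "1 \<odot>\<^bsub>der_lie A\<^esub> d = d"
    using derivation_PiE[OF d'] derivation_closed[OF d']
    by (auto intro!: ext simp: smult_1 PiE_def extensional_def)
  have "(\<lambda>x\<in>carrier A. (- 1) \<odot> d x) \<oplus>\<^bsub>der_lie A\<^esub> d = \<zero>\<^bsub>der_lie A\<^esub>"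
  proof -
    have "(- 1) \<odot> y \<oplus> y = \<zero>" if "y \<in> carrier A" for y
      using that smult_distrib_right[of y "- 1" 1] by (simp add: smult_1 smult_0)
    then show ?thesis
      using derivation_closed[OF d'] by (auto intro!: ext)
  qed
  then show "\<exists>y\<in>carrier (der_lie A). y \<oplus>\<^bsub>der_lie A\<^esub> d = \<zero>\<^bsub>der_lie A\<^esub>"
    using smult_derivation[OF d', of "- 1"] by (intro bexI) (auto simp del: restrict_apply)
qed (auto simp: zero_derivation add_derivation smult_derivation der_simps a_ac smult_smult
    smult_distrib_left smult_distrib_right intro!: ext)

text \<open>The six letters are the values of the six orders of composing three derivations; each
  occurs once with either sign.\<close>

lemma jacobi_cancel:
  assumes "a \<in> carrier A" "b \<in> carrier A" "c \<in> carrier A" "d \<in> carrier A" "e \<in> carrier A" "f \<in> carrier A"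
  shows "((a \<ominus> b) \<ominus> (c \<ominus> d)) \<oplus> ((c \<ominus> e) \<ominus> (f \<ominus> b)) \<oplus> ((f \<ominus> d) \<ominus> (a \<ominus> e)) = \<zero>"
  using assms by algebra

lemma lie_algebra_der_lie: "lie_algebra (der_lie A)"
proof (intro lie_algebra.intro lie_algebra_axioms.intro module_der_lie)
  fix x y z assume "x \<in> carrier (der_lie A)" "y \<in> carrier (der_lie A)"
  then have x: "x \<in> derivations A" and y: "y \<in> derivations A" by simp_all
  note xy = der_simps[OF x] der_simps[OF y]
  show "bracket (der_lie A) x y \<in> carrier (der_lie A)"
    using bracket_derivation[OF x y] by simp
  show "bracket (der_lie A) (c \<odot>\<^bsub>der_lie A\<^esub> x) y = c \<odot>\<^bsub>der_lie A\<^esub> bracket (der_lie A) x y" for c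
    by (auto intro!: ext simp: xy smult_diff)
  show "bracket (der_lie A) x (c \<odot>\<^bsub>der_lie A\<^esub> y) = c \<odot>\<^bsub>der_lie A\<^esub> bracket (der_lie A) x y" for c
    by (auto intro!: ext simp: xy smult_diff)
  show "bracket (der_lie A) x x = \<zero>\<^bsub>der_lie A\<^esub>"
    by (auto intro!: ext simp: xy a_minus_def r_neg)
  assume "z \<in> carrier (der_lie A)"
  then have z: "z \<in> derivations A" by simp
  note xyz = xy der_simps[OF z]
  show "bracket (der_lie A) (x \<oplus>\<^bsub>der_lie A\<^esub> y) z
      = bracket (der_lie A) x z \<oplus>\<^bsub>der_lie A\<^esub> bracket (der_lie A) y z"
    by (auto intro!: ext simp: xyz add_diff_add)
  show "bracket (der_lie A) x (y \<oplus>\<^bsub>der_lie A\<^esub> z)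
      = bracket (der_lie A) x y \<oplus>\<^bsub>der_lie A\<^esub> bracket (der_lie A) x z"
    by (auto intro!: ext simp: xyz add_diff_add)
  show "bracket (der_lie A) x (bracket (der_lie A) y z) \<oplus>\<^bsub>der_lie A\<^esub> bracket (der_lie A) y (bracket (der_lie A) z x)
      \<oplus>\<^bsub>der_lie A\<^esub> bracket (der_lie A) z (bracket (der_lie A) x y) = \<zero>\<^bsub>der_lie A\<^esub>"
    by (auto intro!: ext jacobi_cancel
        simp: xyz derivation_diff[OF x] derivation_diff[OF y] derivation_diff[OF z])
qed

section \<open>Inner derivations\<close>

definition ad :: "'a \<Rightarrow> 'a \<Rightarrow> 'a" where
  "ad a = (\<lambda>x\<in>carrier A. a \<otimes> x \<ominus> x \<otimes> a)"

lemma inner_derivations_eq: "inner_derivations A = ad ` carrier A"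
  unfolding inner_derivations_def ad_def by auto

lemma ad_derivation:
  assumes a: "a \<in> carrier A"
  shows "ad a \<in> derivations A"
proof (rule derivationI)
  show "ad a \<in> carrier A \<rightarrow>\<^sub>E carrier A" using a by (auto simp: ad_def)
  fix c x assume x: "x \<in> carrier A"
  show "ad a (c \<odot> x) = c \<odot> ad a x"
    using a x by (simp add: ad_def smult_mult_left smult_mult_right smult_diff)
  fix y assume y: "y \<in> carrier A"
  show "ad a (x \<oplus> y) = ad a x \<oplus> ad a y"
    using a x y by (simp add: ad_def) algebra
  show "ad a (x \<otimes> y) = ad a x \<otimes> y \<oplus> x \<otimes> ad a y"
    using a x y by (simp add: ad_def) algebra
qed

text \<open>Closure under brackets comes from the identity [d, ad a] = ad (d a).\<close>

lemma lie_ideal_inner: "lie_ideal (inner_derivations A) (der_lie A)"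
  unfolding lie_ideal_def
proof (intro conjI ballI)
  show "submodule (inner_derivations A) scalars (der_lie A)"
    unfolding inner_derivations_eq
  proof (rule submodule_scalarsI[OF module_der_lie])
    show "ad ` carrier A \<subseteq> carrier (der_lie A)" by (auto intro: ad_derivation)
    have "\<zero>\<^bsub>der_lie A\<^esub> = ad \<zero>" by (auto simp: ad_def a_minus_def intro!: ext)
    then show "\<zero>\<^bsub>der_lie A\<^esub> \<in> ad ` carrier A" by auto
    fix f assume "f \<in> ad ` carrier A"
    then obtain a where a: "a \<in> carrier A" "f = ad a" by auto
    have "c \<odot>\<^bsub>der_lie A\<^esub> f = ad (c \<odot> a)" for c
      using a by (auto simp: ad_def smult_diff smult_mult_left smult_mult_right intro!: ext)
    then show "c \<odot>\<^bsub>der_lie A\<^esub> f \<in> ad ` carrier A" for c using a by auto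
    fix g assume "g \<in> ad ` carrier A"
    then obtain b where b: "b \<in> carrier A" "g = ad b" by auto
    have "(a \<otimes> x \<ominus> x \<otimes> a) \<oplus> (b \<otimes> x \<ominus> x \<otimes> b) = (a \<oplus> b) \<otimes> x \<ominus> x \<otimes> (a \<oplus> b)"
      if "x \<in> carrier A" for x
      using a(1) b(1) that by algebra
    then have "f \<oplus>\<^bsub>der_lie A\<^esub> g = ad (a \<oplus> b)"
      using a b by (auto simp: ad_def intro!: ext)
    then show "f \<oplus>\<^bsub>der_lie A\<^esub> g \<in> ad ` carrier A" using a b by auto
  qed
  fix d f assume "d \<in> carrier (der_lie A)" "f \<in> inner_derivations A"
  then obtain a where d: "d \<in> derivations A" and a: "a \<in> carrier A" "f = ad a"
    by (auto simp: inner_derivations_eq)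
  have "d (a \<otimes> x \<ominus> x \<otimes> a) \<ominus> (a \<otimes> d x \<ominus> d x \<otimes> a) = d a \<otimes> x \<ominus> x \<otimes> d a"
    if x: "x \<in> carrier A" for x
  proof -
    have cancel: "(p \<oplus> q) \<ominus> (s \<oplus> t) \<ominus> (q \<ominus> s) = p \<ominus> t"
      if "p \<in> carrier A" "q \<in> carrier A" "s \<in> carrier A" "t \<in> carrier A" for p q s t
      using that by algebra
    show ?thesis
      using x a(1) by (simp add: der_simps[OF d] derivation_diff[OF d] cancel)
  qed
  then have "bracket (der_lie A) d f = ad (d a)"
    using a d by (auto simp: ad_def der_simps intro!: ext)
  then show "bracket (der_lie A) d f \<in> inner_derivations A"
    using a d by (auto simp: inner_derivations_eq der_simps)
qed

sublocale HH: quotient_lie_algebra "der_lie A" "inner_derivations A"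
  rewrites "quot_lie (der_lie A) (inner_derivations A) = HH1 A"
  by (intro quotient_lie_algebra.intro quotient_lie_algebra_axioms.intro
      lie_algebra_der_lie lie_ideal_inner) (simp add: HH1_def)

text \<open>A complete family of orthogonal idempotents spans a separable subalgebra, and every
  derivation from it into \<open>A\<close> is inner. The witness, the sum of the d(e_i) e_i, comes
  from the separability idempotent, the sum of the e_i tensor e_i.\<close>

lemma derivation_eq_ad_on_idempotents:
  assumes d: "d \<in> derivations A" and fin: "finite I"
    and e: "\<And>i. i \<in> I \<Longrightarrow> e i \<in> carrier A"
    and idem: "\<And>i. i \<in> I \<Longrightarrow> e i \<otimes> e i = e i"
    and orth: "\<And>i j. \<lbrakk>i \<in> I; j \<in> I; i \<noteq> j\<rbrakk> \<Longrightarrow> e i \<otimes> e j = \<zero>"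
    and sum: "(\<Oplus>i\<in>I. e i) = \<one>"
  shows "\<exists>a\<in>carrier A. \<forall>i\<in>I. d (e i) = ad a (e i)"
proof
  define a where "a = (\<Oplus>i\<in>I. d (e i) \<otimes> e i)"
  note dc = derivation_closed[OF d]
  have de: "d (e i) \<in> carrier A" if "i \<in> I" for i using e[OF that] by (rule dc)
  show a: "a \<in> carrier A" unfolding a_def using e de by (auto intro!: finsum_closed)
  show "\<forall>j\<in>I. d (e j) = ad a (e j)"
  proof
    fix j assume j: "j \<in> I"
    have delta: "(\<Oplus>i\<in>I. if i = j then x else \<zero>) = x" if "x \<in> carrier A" for x
      using finsum_singleton[of j I "\<lambda>_. x"] j fin that by (simp add: eq_commute cong: if_cong)
    have x: "d (e j) \<otimes> e j \<in> carrier A" using e de j by simp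
    have "a \<otimes> e j = (\<Oplus>i\<in>I. (d (e i) \<otimes> e i) \<otimes> e j)"
      unfolding a_def using fin e de j by (intro finsum_ldistr) auto
    also have "\<dots> = (\<Oplus>i\<in>I. if i = j then d (e j) \<otimes> e j else \<zero>)"
      using e de j idem orth by (intro finsum_cong') (auto simp: m_assoc)
    finally have 1: "a \<otimes> e j = d (e j) \<otimes> e j" using delta[OF x] by simp
    \<comment> \<open>Writing d(e_j) as d(e_j) times the sum of all e_i allows the two sums to be
      merged term by term.\<close>
    have "e j \<otimes> a \<oplus> d (e j) \<otimes> (\<Oplus>i\<in>I. e i)
        = (\<Oplus>i\<in>I. e j \<otimes> (d (e i) \<otimes> e i)) \<oplus> (\<Oplus>i\<in>I. d (e j) \<otimes> e i)"
      unfolding a_def using fin e de j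
      by (intro arg_cong2[where f = "add A"] finsum_rdistr) auto
    also have "\<dots> = (\<Oplus>i\<in>I. e j \<otimes> (d (e i) \<otimes> e i) \<oplus> d (e j) \<otimes> e i)"
      using e de j by (intro finsum_addf[symmetric]) auto
    also have "\<dots> = (\<Oplus>i\<in>I. if i = j then d (e j) \<otimes> e j else \<zero>)"
    proof (intro finsum_cong')
      fix i assume i: "i \<in> I"
      \<comment> \<open>Leibniz for e_j e_i, using e_i e_i = e_i. Off the diagonal e_j e_i = 0, so
        only the term i = j survives.\<close>
      have "e j \<otimes> (d (e i) \<otimes> e i) \<oplus> d (e j) \<otimes> e i = d (e j \<otimes> e i) \<otimes> e i"
        using e[OF i] e[OF j] de[OF i] de[OF j] idem[OF i]
        by (simp add: derivation_mult[OF d] l_distr m_assoc a_comm)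
      then show "e j \<otimes> (d (e i) \<otimes> e i) \<oplus> d (e j) \<otimes> e i = (if i = j then d (e j) \<otimes> e j else \<zero>)"
        using i j idem orth e by (simp add: derivation_zero[OF d])
    qed (use x in auto)
    finally have "e j \<otimes> a \<oplus> d (e j) = a \<otimes> e j"
      using 1 delta[OF x] de[OF j] by (simp add: sum)
    then have "ad a (e j) = (d (e j) \<oplus> e j \<otimes> a) \<ominus> e j \<otimes> a"
      using a e[OF j] de[OF j] by (simp add: ad_def a_comm)
    also have "\<dots> = d (e j)"
      using a e[OF j] de[OF j] by (simp add: a_minus_def a_assoc r_neg)
    finally show "d (e j) = ad a (e j)" ..
  qed
qed

end

section \<open>Extensions of one-dimensional modules\<close>

text \<open>Closure of \<open>M\<close> under its two operations is the form in which free modules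
  and syzygies are supplied below; the vector space laws are inherited pointwise from
  \<open>N\<close>.\<close>

lemma (in kalgebra) module_hom_space:
  assumes N: "left_module A N"
    and add: "\<And>x y. \<lbrakk>x \<in> carrier M; y \<in> carrier M\<rbrakk> \<Longrightarrow> x \<oplus>\<^bsub>M\<^esub> y \<in> carrier M"
    and smult: "\<And>a x. \<lbrakk>a \<in> carrier A; x \<in> carrier M\<rbrakk> \<Longrightarrow> a \<odot>\<^bsub>M\<^esub> x \<in> carrier M"
  shows "module scalars (hom_space A M N)"
proof -
  interpret N: left_module A N by fact
  let ?H = "hom_space A M N"
  have homI: "f \<in> carrier ?H"
    if "f \<in> carrier M \<rightarrow>\<^sub>E carrier N"
      "\<And>x y. \<lbrakk>x \<in> carrier M; y \<in> carrier M\<rbrakk> \<Longrightarrow> f (x \<oplus>\<^bsub>M\<^esub> y) = f x \<oplus>\<^bsub>N\<^esub> f y"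
      "\<And>a x. \<lbrakk>a \<in> carrier A; x \<in> carrier M\<rbrakk> \<Longrightarrow> f (a \<odot>\<^bsub>M\<^esub> x) = a \<odot>\<^bsub>N\<^esub> f x" for f
    using that by (auto simp: hom_space_def module_homs_def)
  have hom_closed: "f x \<in> carrier N" if "f \<in> carrier ?H" "x \<in> carrier M" for f x
    using that by (auto simp: hom_space_def module_homs_def)
  have hom_add: "f (x \<oplus>\<^bsub>M\<^esub> y) = f x \<oplus>\<^bsub>N\<^esub> f y"
    if "f \<in> carrier ?H" "x \<in> carrier M" "y \<in> carrier M" for f x y
    using that by (auto simp: hom_space_def module_homs_def)
  have hom_smult: "f (a \<odot>\<^bsub>M\<^esub> x) = a \<odot>\<^bsub>N\<^esub> f x"
    if "f \<in> carrier ?H" "a \<in> carrier A" "x \<in> carrier M" for f a x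
    using that by (auto simp: hom_space_def module_homs_def)
  have hom_eqI: "f = g"
    if "f \<in> carrier ?H" "g \<in> carrier ?H" "\<And>x. x \<in> carrier M \<Longrightarrow> f x = g x" for f g
    using that by (auto simp: hom_space_def module_homs_def intro: PiE_ext)
  have addH: "f \<oplus>\<^bsub>?H\<^esub> g = (\<lambda>x\<in>carrier M. f x \<oplus>\<^bsub>N\<^esub> g x)" for f g
    by (simp add: hom_space_def)
  have smultH: "c \<odot>\<^bsub>?H\<^esub> f = (\<lambda>x\<in>carrier M. (c \<odot> \<one>) \<odot>\<^bsub>N\<^esub> f x)" for c f
    by (simp add: hom_space_def)
  have zeroH: "\<zero>\<^bsub>?H\<^esub> = (\<lambda>x\<in>carrier M. \<zero>\<^bsub>N\<^esub>)"
    by (simp add: hom_space_def)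
  have smult_null: "a \<odot>\<^bsub>N\<^esub> \<zero>\<^bsub>N\<^esub> = \<zero>\<^bsub>N\<^esub>" if "a \<in> carrier A" for a
    using N.smult_r_distr[OF that, of "\<zero>\<^bsub>N\<^esub>" "\<zero>\<^bsub>N\<^esub>"] N.smult_closed[OF that, of "\<zero>\<^bsub>N\<^esub>"]
    by (metis N.M.add.l_cancel_one' N.M.l_zero N.M.zero_closed)
  \<comment> \<open>Multiples of the identity are central in \<open>A\<close>, so scaling a
    homomorphism keeps it \<open>A\<close>-linear.\<close>
  have central: "a \<odot>\<^bsub>N\<^esub> ((c \<odot> \<one>) \<odot>\<^bsub>N\<^esub> y) = (c \<odot> \<one>) \<odot>\<^bsub>N\<^esub> (a \<odot>\<^bsub>N\<^esub> y)"
    if "a \<in> carrier A" "y \<in> carrier N" for a c y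
    using that N.smult_assoc[of a "c \<odot> \<one>" y] N.smult_assoc[of "c \<odot> \<one>" a y]
    by (simp add: smult_mult_left smult_mult_right)
  have add_closedH: "f \<oplus>\<^bsub>?H\<^esub> g \<in> carrier ?H" if "f \<in> carrier ?H" "g \<in> carrier ?H" for f g
    unfolding addH using that
    by (intro homI) (auto simp: hom_closed hom_add hom_smult add smult N.smult_r_distr N.M.a_ac)
  have zero_closedH: "\<zero>\<^bsub>?H\<^esub> \<in> carrier ?H"
    unfolding zeroH by (intro homI) (auto simp: add smult smult_null)
  have smult_closedH: "c \<odot>\<^bsub>?H\<^esub> f \<in> carrier ?H" if "f \<in> carrier ?H" for c f
    unfolding smultH using that
    by (intro homI) (auto simp: hom_closed hom_add hom_smult add smult N.smult_r_distr central
        N.smult_closed)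
  show ?thesis
  proof (intro module_scalarsI abelian_groupI)
    fix f assume f: "f \<in> carrier ?H"
    show "\<zero>\<^bsub>?H\<^esub> \<oplus>\<^bsub>?H\<^esub> f = f"
      using f add_closedH[OF zero_closedH f] by (intro hom_eqI) (auto simp: addH zeroH hom_closed)
    show "1 \<odot>\<^bsub>?H\<^esub> f = f"
      using f smult_closedH[OF f, of 1]
      by (intro hom_eqI) (auto simp: smultH hom_closed smult_1 N.smult_one)
    have "(- 1) \<odot>\<^bsub>?H\<^esub> f \<oplus>\<^bsub>?H\<^esub> f = \<zero>\<^bsub>?H\<^esub>"
    proof (intro hom_eqI add_closedH smult_closedH zero_closedH f)
      fix x assume x: "x \<in> carrier M"
      have y: "f x \<in> carrier N" using f x by (rule hom_closed)
      have null: "\<zero> \<odot>\<^bsub>N\<^esub> f x = \<zero>\<^bsub>N\<^esub>"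
        using N.smult_l_distr[of \<zero> \<zero> "f x"] N.smult_closed[of \<zero> "f x"] y
        by (metis N.M.add.l_cancel_one' l_zero zero_closed)
      have "((- 1) \<odot> \<one>) \<odot>\<^bsub>N\<^esub> f x \<oplus>\<^bsub>N\<^esub> f x = (((- 1) \<odot> \<one>) \<oplus> \<one>) \<odot>\<^bsub>N\<^esub> f x"
        using N.smult_l_distr[of "(- 1) \<odot> \<one>" \<one> "f x"] y by (simp add: N.smult_one)
      also have "((- 1) \<odot> \<one>) \<oplus> \<one> = \<zero>"
        using smult_distrib_right[of \<one> "- 1" 1] by (simp add: smult_1 smult_0)
      finally show "((- 1) \<odot>\<^bsub>?H\<^esub> f \<oplus>\<^bsub>?H\<^esub> f) x = \<zero>\<^bsub>?H\<^esub> x"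
        using x null by (simp add: addH smultH zeroH)
    qed
    then show "\<exists>g\<in>carrier ?H. g \<oplus>\<^bsub>?H\<^esub> f = \<zero>\<^bsub>?H\<^esub>"
      using smult_closedH[OF f] by blast
  next
    fix f g k assume f: "f \<in> carrier ?H" and g: "g \<in> carrier ?H"
    show "f \<oplus>\<^bsub>?H\<^esub> g \<in> carrier ?H" using f g by (rule add_closedH)
    show "f \<oplus>\<^bsub>?H\<^esub> g = g \<oplus>\<^bsub>?H\<^esub> f"
      using f g by (auto simp: addH hom_closed N.M.a_comm intro!: ext)
    show "c \<odot>\<^bsub>?H\<^esub> (f \<oplus>\<^bsub>?H\<^esub> g) = c \<odot>\<^bsub>?H\<^esub> f \<oplus>\<^bsub>?H\<^esub> c \<odot>\<^bsub>?H\<^esub> g" for c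
      using f g by (auto simp: addH smultH hom_closed N.smult_r_distr intro!: ext)
    assume k: "k \<in> carrier ?H"
    show "f \<oplus>\<^bsub>?H\<^esub> g \<oplus>\<^bsub>?H\<^esub> k = f \<oplus>\<^bsub>?H\<^esub> (g \<oplus>\<^bsub>?H\<^esub> k)"
      using f g k by (auto simp: addH hom_closed N.M.a_assoc intro!: ext)
  next
    fix b c f assume f: "f \<in> carrier ?H"
    show "(b + c) \<odot>\<^bsub>?H\<^esub> f = b \<odot>\<^bsub>?H\<^esub> f \<oplus>\<^bsub>?H\<^esub> c \<odot>\<^bsub>?H\<^esub> f"
      using f by (auto simp: addH smultH hom_closed smult_distrib_right N.smult_l_distr intro!: ext)
    show "(b * c) \<odot>\<^bsub>?H\<^esub> f = b \<odot>\<^bsub>?H\<^esub> (c \<odot>\<^bsub>?H\<^esub> f)"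
    proof (intro hom_eqI smult_closedH f)
      fix x assume x: "x \<in> carrier M"
      show "((b * c) \<odot>\<^bsub>?H\<^esub> f) x = (b \<odot>\<^bsub>?H\<^esub> (c \<odot>\<^bsub>?H\<^esub> f)) x"
        using x hom_closed[OF f x] N.smult_assoc[of "b \<odot> \<one>" "c \<odot> \<one>" "f x"]
        by (simp add: smultH smult_mult_left smult_mult_right smult_smult mult.commute)
    qed
  qed (auto simp: zero_closedH smult_closedH)
qed

text \<open>An empty family has infimum \<open>\<infinity>\<close>, which the bound excludes; a
  nonempty set of extended naturals attains its infimum, so some spanning set realises the
  dimension.\<close>

lemma vs_dim_le_1E:
  assumes "vs_dim V \<le> 1"
  obtains B where "finite B" "card B \<le> 1" "B \<subseteq> carrier V" "lin_span V B = carrier V"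
proof -
  let ?S = "{enat (card B) | B. finite B \<and> B \<subseteq> carrier V \<and> lin_span V B = carrier V}"
  have "?S \<noteq> {}"
    using assms unfolding vs_dim_def by (auto simp: Inf_enat_def split: if_splits)
  then have "Inf ?S \<in> ?S"
    unfolding Inf_enat_def using LeastI_ex[of "\<lambda>x. x \<in> ?S"] by auto
  then show thesis
    using assms that unfolding vs_dim_def[symmetric] by (auto simp: one_enat_def)
qed

section \<open>One-dimensional simple modules given by characters\<close>

context kalgebra
begin

definition character :: "('a \<Rightarrow> 'k) \<Rightarrow> bool" where
  "character \<epsilon> \<longleftrightarrow> \<epsilon> \<one> = 1 \<and>
     (\<forall>x\<in>carrier A. \<forall>y\<in>carrier A. \<epsilon> (x \<oplus> y) = \<epsilon> x + \<epsilon> y \<and> \<epsilon> (x \<otimes> y) = \<epsilon> x * \<epsilon> y) \<and>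
     (\<forall>c. \<forall>x\<in>carrier A. \<epsilon> (c \<odot> x) = c * \<epsilon> x)"

text \<open>The line through \<open>e\<close> is taken inside \<open>A\<close> so that the module
  has the element type over which the Ext hypothesis quantifies; the action is by the scalar
  \<open>\<epsilon> x\<close>, not by multiplication in \<open>A\<close>. If
  \<open>\<epsilon> e = 1\<close>, then \<open>\<epsilon>\<close> is also the coordinate on this
  line.\<close>

definition char_module :: "('a \<Rightarrow> 'k) \<Rightarrow> 'a \<Rightarrow> ('a, 'a) module" where
  "char_module \<epsilon> e =
     \<lparr> carrier = range (\<lambda>c. c \<odot> e), monoid.mult = undefined, one = undefined,
       ring.zero = \<zero>, add = add A, module.smult = (\<lambda>x s. \<epsilon> x \<odot> s) \<rparr>"

lemma char_module_carrier: "carrier (char_module \<epsilon> e) = range (\<lambda>c. c \<odot> e)"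
  by (simp add: char_module_def)

lemma char_module_simps [simp]:
  "\<zero>\<^bsub>char_module \<epsilon> e\<^esub> = \<zero>" "x \<oplus>\<^bsub>char_module \<epsilon> e\<^esub> y = x \<oplus> y"
  "a \<odot>\<^bsub>char_module \<epsilon> e\<^esub> x = \<epsilon> a \<odot> x"
  by (simp_all add: char_module_def)

lemma left_module_char_module:
  assumes \<epsilon>: "character \<epsilon>" and e: "e \<in> carrier A"
  shows "left_module A (char_module \<epsilon> e)"
proof (intro left_module.intro left_module_axioms.intro abelian_groupI)
  let ?S = "char_module \<epsilon> e"
  note \<epsilon>' = \<epsilon>[unfolded character_def]
  have mem: "x \<in> carrier ?S \<longleftrightarrow> (\<exists>c. x = c \<odot> e)" for x
    by (auto simp: char_module_carrier)
  show "ring A" by (rule ring_axioms)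
  show "\<zero>\<^bsub>?S\<^esub> \<in> carrier ?S"
    unfolding mem using smult_0[OF e] by (intro exI[of _ 0]) simp
  fix x assume "x \<in> carrier ?S"
  then obtain c where c: "x = c \<odot> e" by (auto simp: mem)
  have x: "x \<in> carrier A" using c e by simp
  show "\<zero>\<^bsub>?S\<^esub> \<oplus>\<^bsub>?S\<^esub> x = x" using x by simp
  show "\<one> \<odot>\<^bsub>?S\<^esub> x = x" using x \<epsilon>' by (simp add: smult_1)
  have "((- c) \<odot> e) \<oplus> x = \<zero>"
    using smult_distrib_right[OF e, of "- c" c] c e by (simp add: smult_0)
  then show "\<exists>y\<in>carrier ?S. y \<oplus>\<^bsub>?S\<^esub> x = \<zero>\<^bsub>?S\<^esub>" using mem by auto
  {
    fix a assume a: "a \<in> carrier A"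
    show "a \<odot>\<^bsub>?S\<^esub> x \<in> carrier ?S" using c e by (auto simp: mem smult_smult)
    fix b assume b: "b \<in> carrier A"
    show "(a \<oplus> b) \<odot>\<^bsub>?S\<^esub> x = a \<odot>\<^bsub>?S\<^esub> x \<oplus>\<^bsub>?S\<^esub> b \<odot>\<^bsub>?S\<^esub> x"
      "(a \<otimes> b) \<odot>\<^bsub>?S\<^esub> x = a \<odot>\<^bsub>?S\<^esub> (b \<odot>\<^bsub>?S\<^esub> x)"
      using a b x \<epsilon>' by (simp_all add: smult_distrib_right smult_smult)
  }
  fix y assume "y \<in> carrier ?S"
  then obtain c' where c': "y = c' \<odot> e" by (auto simp: mem)
  have y: "y \<in> carrier A" using c' e by simp
  show "x \<oplus>\<^bsub>?S\<^esub> y \<in> carrier ?S"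
    using c c' smult_distrib_right[OF e, of c c'] by (auto simp: mem intro: exI[of _ "c + c'"])
  show "x \<oplus>\<^bsub>?S\<^esub> y = y \<oplus>\<^bsub>?S\<^esub> x" using x y by (simp add: a_comm)
  show "a \<odot>\<^bsub>?S\<^esub> (x \<oplus>\<^bsub>?S\<^esub> y) = a \<odot>\<^bsub>?S\<^esub> x \<oplus>\<^bsub>?S\<^esub> a \<odot>\<^bsub>?S\<^esub> y" for a
    using x y by (simp add: smult_distrib_left)
  fix z assume "z \<in> carrier ?S"
  then have "z \<in> carrier A" using e by (auto simp: mem)
  then show "x \<oplus>\<^bsub>?S\<^esub> y \<oplus>\<^bsub>?S\<^esub> z = x \<oplus>\<^bsub>?S\<^esub> (y \<oplus>\<^bsub>?S\<^esub> z)" using x y by (simp add: a_assoc)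
qed

lemma simple_char_module:
  assumes \<epsilon>: "character \<epsilon>" and e: "e \<in> carrier A" and \<epsilon>e: "\<epsilon> e = 1"
  shows "simple_module A (char_module \<epsilon> e)"
  unfolding simple_module_def
proof (intro conjI allI impI)
  let ?S = "char_module \<epsilon> e"
  show S: "left_module A ?S" using \<epsilon> e by (rule left_module_char_module)
  then interpret S: left_module A ?S .
  have \<epsilon>0: "\<epsilon> \<zero> = 0"
    using \<epsilon> smult_0[OF zero_closed] unfolding character_def by (metis mult_zero_left zero_closed)
  show "carrier ?S \<noteq> {\<zero>\<^bsub>?S\<^esub>}"
    proof
    assume "carrier ?S = {\<zero>\<^bsub>?S\<^esub>}"
    moreover have "1 \<odot> e \<in> carrier ?S" by (auto simp: char_module_carrier)
    ultimately show False using \<epsilon>e \<epsilon>0 smult_1[OF e] by simp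
  qed
  fix N assume N: "submodule N A ?S"
  note N' = submoduleD[OF N S.M.abelian_group_axioms]
  show "N = {\<zero>\<^bsub>?S\<^esub>} \<or> N = carrier ?S"
  proof (cases "N \<subseteq> {\<zero>}")
    case True
    then show ?thesis using N'(2) by auto
  next
    case False
    then obtain c where c: "c \<odot> e \<in> N" "c \<odot> e \<noteq> \<zero>" using N'(1) by (auto simp: char_module_carrier)
    then have "c \<noteq> 0" using smult_0[OF e] by auto
    have "b \<odot> e \<in> N" for b
      \<comment> \<open>The ring element (b / c) 1 acts as the scalar b / c, so one nonzero vector
        generates the whole line.\<close>
      using N'(4)[of "(b / c) \<odot> \<one>" "c \<odot> e"] c \<epsilon> e \<open>c \<noteq> 0\<close>
      by (simp add: character_def smult_smult)
    then show ?thesis using N'(1) by (auto simp: char_module_carrier)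
  qed
qed

end

text \<open>
  The cocycles \<open>g\<close> and \<open>h\<close> give homomorphisms from the syzygy of \<open>S\<close> to \<open>T\<close>.  Homomorphisms that extend
  to the free module vanish on the generator \<open>[e]\<close> multiplied by \<open>p\<close> or \<open>q\<close>, and these two elements
  separate the cocycles.
\<close>

locale two_cocycles = kalgebra A for A :: "('k::field, 'a, 'z) module_scheme" (structure) +
  fixes \<epsilon> \<eta> :: "'a \<Rightarrow> 'k" and e f :: 'a and g h :: "'a \<Rightarrow> 'k" and p q :: 'a
  assumes \<epsilon>: "character \<epsilon>" and \<eta>: "character \<eta>"
    and e: "e \<in> carrier A" "\<epsilon> e = 1" and f: "f \<in> carrier A" "\<eta> f = 1"
    and pq: "p \<in> carrier A" "q \<in> carrier A" "\<epsilon> p = 0" "\<epsilon> q = 0" "\<eta> p = 0" "\<eta> q = 0"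
    and cocycle_add: "\<And>k x y. \<lbrakk>k \<in> {g, h}; x \<in> carrier A; y \<in> carrier A\<rbrakk> \<Longrightarrow> k (x \<oplus> y) = k x + k y"
    and cocycle_mult: "\<And>k x y. \<lbrakk>k \<in> {g, h}; x \<in> carrier A; y \<in> carrier A\<rbrakk>
        \<Longrightarrow> k (x \<otimes> y) = k x * \<epsilon> y + \<eta> x * k y"
    and dual: "g p = 1" "g q = 0" "h p = 0" "h q = 1"
begin

abbreviation "S \<equiv> char_module \<epsilon> e"
abbreviation "T \<equiv> char_module \<eta> f"
abbreviation "F \<equiv> free_module A (carrier S)"
abbreviation "\<Omega> \<equiv> syzygy A S"
abbreviation "\<delta> x \<equiv> (\<lambda>s. if s = e then x else \<zero>)"

text \<open>On the line through \<open>e\<close>, \<open>\<epsilon> s\<close> is the coordinate of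
  \<open>s\<close>. Thus \<open>pairing \<epsilon> \<phi>\<close> is the coordinate of
  \<open>cover A S \<phi>\<close>, and for a cocycle \<open>k\<close> the pairing extends
  \<open>k\<close> additively from \<open>A\<close> to the free module, sending x times the
  generator [s] to k(x) times that coordinate.\<close>

definition pairing :: "('a \<Rightarrow> 'k) \<Rightarrow> ('a \<Rightarrow> 'a) \<Rightarrow> 'k" where
  "pairing k \<phi> = (\<Sum>s | \<phi> s \<noteq> \<zero>. k (\<phi> s) * \<epsilon> s)"

lemma F_simps:
  "carrier F = {\<phi>. (\<forall>x. \<phi> x \<in> carrier A) \<and> finite {x. \<phi> x \<noteq> \<zero>} \<and> {x. \<phi> x \<noteq> \<zero>} \<subseteq> carrier S}"
  "\<phi> \<oplus>\<^bsub>F\<^esub> \<psi> = (\<lambda>x. \<phi> x \<oplus> \<psi> x)" "a \<odot>\<^bsub>F\<^esub> \<phi> = (\<lambda>x. a \<otimes> \<phi> x)"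
  by (simp_all add: free_module_def)

lemma F_add:
  assumes "\<phi> \<in> carrier F" "\<psi> \<in> carrier F"
  shows "\<phi> \<oplus>\<^bsub>F\<^esub> \<psi> \<in> carrier F"
proof -
  have "{x. \<phi> x \<oplus> \<psi> x \<noteq> \<zero>} \<subseteq> {x. \<phi> x \<noteq> \<zero>} \<union> {x. \<psi> x \<noteq> \<zero>}" by auto
  then show ?thesis
    using assms by (auto simp: F_simps intro: finite_subset)
qed

lemma F_smult: "\<lbrakk>a \<in> carrier A; \<phi> \<in> carrier F\<rbrakk> \<Longrightarrow> a \<odot>\<^bsub>F\<^esub> \<phi> \<in> carrier F"
  by (auto simp: F_simps intro: rev_finite_subset[of "{x. \<phi> x \<noteq> \<zero>}"])

lemma additive_zero:
  assumes "\<And>x y. \<lbrakk>x \<in> carrier A; y \<in> carrier A\<rbrakk> \<Longrightarrow> k (x \<oplus> y) = k x + (k y :: 'k)"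
  shows "k \<zero> = 0"
  using assms[of \<zero> \<zero>] by (metis add_cancel_right_right l_zero zero_closed)

lemma pairing_superset:
  assumes "finite B" "{s. \<phi> s \<noteq> \<zero>} \<subseteq> B" "k \<zero> = 0"
  shows "pairing k \<phi> = (\<Sum>s\<in>B. k (\<phi> s) * \<epsilon> s)"
  unfolding pairing_def using assms by (intro sum.mono_neutral_left) auto

lemma pairing_add:
  assumes k: "\<And>x y. \<lbrakk>x \<in> carrier A; y \<in> carrier A\<rbrakk> \<Longrightarrow> k (x \<oplus> y) = k x + k y"
    and \<phi>: "\<phi> \<in> carrier F" and \<psi>: "\<psi> \<in> carrier F"
  shows "pairing k (\<phi> \<oplus>\<^bsub>F\<^esub> \<psi>) = pairing k \<phi> + pairing k \<psi>"
proof -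
  let ?X = "{x. \<phi> x \<noteq> \<zero>} \<union> {x. \<psi> x \<noteq> \<zero>}"
  have X: "finite ?X" using \<phi> \<psi> by (simp add: F_simps)
  have k0: "k \<zero> = 0" using k by (rule additive_zero)
  have "pairing k (\<phi> \<oplus>\<^bsub>F\<^esub> \<psi>) = (\<Sum>s\<in>?X. k (\<phi> s \<oplus> \<psi> s) * \<epsilon> s)"
    by (subst pairing_superset[where k = k, OF X _ k0]) (auto simp: F_simps)
  also have "\<dots> = (\<Sum>s\<in>?X. k (\<phi> s) * \<epsilon> s) + (\<Sum>s\<in>?X. k (\<psi> s) * \<epsilon> s)"
    using \<phi> \<psi> by (simp add: F_simps k distrib_right sum.distrib)
  also have "\<dots> = pairing k \<phi> + pairing k \<psi>"
    using pairing_superset[of ?X \<phi> k] pairing_superset[of ?X \<psi> k] X k0 by simp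
  finally show ?thesis .
qed

text \<open>One rule for two uses: \<open>l = 0\<close> with \<open>\<eta>' = \<epsilon>\<close>
  treats the character itself; \<open>l = k\<close> with \<open>\<eta>' = \<eta>\<close> treats a
  cocycle, whose failure to be linear is a multiple of
  \<open>pairing \<epsilon> \<phi>\<close>.\<close>

lemma pairing_smult:
  assumes k: "\<And>x y. \<lbrakk>x \<in> carrier A; y \<in> carrier A\<rbrakk> \<Longrightarrow> k (x \<oplus> y) = k x + k y"
    and k': "\<And>x y. \<lbrakk>x \<in> carrier A; y \<in> carrier A\<rbrakk> \<Longrightarrow> k (x \<otimes> y) = l x * \<epsilon> y + \<eta>' x * k y"
    and \<phi>: "\<phi> \<in> carrier F" and a: "a \<in> carrier A"
  shows "pairing k (a \<odot>\<^bsub>F\<^esub> \<phi>) = l a * pairing \<epsilon> \<phi> + \<eta>' a * pairing k \<phi>"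
proof -
  let ?X = "{x. \<phi> x \<noteq> \<zero>}"
  have X: "finite ?X" using \<phi> by (simp add: F_simps)
  have k0: "k \<zero> = 0" using k by (rule additive_zero)
  have "pairing k (a \<odot>\<^bsub>F\<^esub> \<phi>) = (\<Sum>s\<in>?X. k (a \<otimes> \<phi> s) * \<epsilon> s)"
    by (subst pairing_superset[where k = k, OF X _ k0]) (use a in \<open>auto simp: F_simps\<close>)
  also have "\<dots> = (\<Sum>s\<in>?X. l a * (\<epsilon> (\<phi> s) * \<epsilon> s) + \<eta>' a * (k (\<phi> s) * \<epsilon> s))"
    using a \<phi> by (intro sum.cong) (auto simp: F_simps k' algebra_simps)
  also have "\<dots> = l a * pairing \<epsilon> \<phi> + \<eta>' a * pairing k \<phi>"
    by (simp add: sum.distrib sum_distrib_left pairing_def)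
  finally show ?thesis .
qed

lemma \<epsilon>_add: "\<lbrakk>x \<in> carrier A; y \<in> carrier A\<rbrakk> \<Longrightarrow> \<epsilon> (x \<oplus> y) = \<epsilon> x + \<epsilon> y"
  using \<epsilon> by (simp add: character_def)

text \<open>The zero summand brings multiplicativity into the shape that
  \<open>pairing_smult\<close> expects, with \<open>l = 0\<close>.\<close>

lemma \<epsilon>_mult: "\<lbrakk>x \<in> carrier A; y \<in> carrier A\<rbrakk> \<Longrightarrow> \<epsilon> (x \<otimes> y) = 0 * \<epsilon> y + \<epsilon> x * \<epsilon> y"
  using \<epsilon> by (simp add: character_def)

lemma smult_e_eq_zero_iff: "c \<odot> e = \<zero> \<longleftrightarrow> c = 0"
proof
  assume "c \<odot> e = \<zero>"
  then have "\<epsilon> (c \<odot> e) = 0" using additive_zero[OF \<epsilon>_add] by simp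
  then show "c = 0" using \<epsilon> e by (simp add: character_def)
qed (use e in \<open>simp add: smult_0\<close>)

lemma smult_f_eq_zero_iff: "c \<odot> f = \<zero> \<longleftrightarrow> c = 0"
proof
  assume "c \<odot> f = \<zero>"
  moreover have "\<eta> \<zero> = 0" using \<eta> by (intro additive_zero) (simp add: character_def)
  ultimately have "\<eta> (c \<odot> f) = 0" by simp
  then show "c = 0" using \<eta> f by (simp add: character_def)
qed (use f in \<open>simp add: smult_0\<close>)

lemma cover_eq:
  assumes \<phi>: "\<phi> \<in> carrier F"
  shows "cover A S \<phi> = pairing \<epsilon> \<phi> \<odot> e"
proof -
  interpret S: left_module A S using \<epsilon> e(1) by (rule left_module_char_module)
  have *: "finsum S (\<lambda>s. \<phi> s \<odot>\<^bsub>S\<^esub> s) B = (\<Sum>s\<in>B. \<epsilon> (\<phi> s) * \<epsilon> s) \<odot> e"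
    if "finite B" "B \<subseteq> carrier S" for B
    using that
  proof (induction B rule: finite_induct)
    case empty
    then show ?case using e by (simp add: smult_0)
  next
    case (insert s B)
    then obtain c where c: "s = c \<odot> e" by (auto simp: char_module_carrier)
    then have "\<epsilon> s = c" using \<epsilon> e by (simp add: character_def)
    moreover have "\<And>t. t \<in> insert s B \<Longrightarrow> \<phi> t \<odot>\<^bsub>S\<^esub> t \<in> carrier S"
      using insert.prems \<phi> by (intro S.smult_closed) (auto simp: F_simps)
    ultimately show ?case
      using insert c e by (subst S.M.finsum_insert) (auto simp: char_module_carrier smult_smult smult_distrib_right)
  qed
  show ?thesis unfolding cover_def pairing_def using \<phi> by (intro *) (auto simp: F_simps)
qed

lemma \<Omega>_simps:
  "carrier \<Omega> = {\<phi> \<in> carrier F. pairing \<epsilon> \<phi> = 0}" "add \<Omega> = add F" "module.smult \<Omega> = module.smult F"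
proof -
  have "\<zero>\<^bsub>S\<^esub> = \<zero>" by simp
  then show "carrier \<Omega> = {\<phi> \<in> carrier F. pairing \<epsilon> \<phi> = 0}"
    unfolding syzygy_def using cover_eq smult_e_eq_zero_iff by (auto)
qed (simp_all add: syzygy_def)

lemma \<Omega>_add: "\<lbrakk>\<phi> \<in> carrier \<Omega>; \<psi> \<in> carrier \<Omega>\<rbrakk> \<Longrightarrow> \<phi> \<oplus>\<^bsub>\<Omega>\<^esub> \<psi> \<in> carrier \<Omega>"
  using F_add pairing_add[OF \<epsilon>_add] by (auto simp: \<Omega>_simps)

lemma \<Omega>_smult: "\<lbrakk>a \<in> carrier A; \<phi> \<in> carrier \<Omega>\<rbrakk> \<Longrightarrow> a \<odot>\<^bsub>\<Omega>\<^esub> \<phi> \<in> carrier \<Omega>"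
  using F_smult pairing_smult[where l = "\<lambda>_. 0", OF \<epsilon>_add \<epsilon>_mult]
  by (auto simp: \<Omega>_simps)

lemma T: "left_module A T"
  using \<eta> f(1) by (rule left_module_char_module)

definition cocycle_hom :: "('a \<Rightarrow> 'k) \<Rightarrow> ('a \<Rightarrow> 'a) \<Rightarrow> 'a" where
  "cocycle_hom k = (\<lambda>\<phi>\<in>carrier \<Omega>. pairing k \<phi> \<odot> f)"

text \<open>On the syzygy \<open>pairing \<epsilon>\<close> vanishes, which removes the term of
  \<open>pairing_smult\<close> that keeps a cocycle from being linear. What remains is
  multiplication by \<open>\<eta> a\<close>, the action on \<open>T\<close>.\<close>

lemma cocycle_hom: "k \<in> {g, h} \<Longrightarrow> cocycle_hom k \<in> module_homs A \<Omega> T"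
  unfolding module_homs_def
proof (intro CollectI conjI ballI)
  assume k: "k \<in> {g, h}"
  show "cocycle_hom k \<in> carrier \<Omega> \<rightarrow>\<^sub>E carrier T" by (auto simp: cocycle_hom_def char_module_carrier)
  fix \<phi> assume \<phi>: "\<phi> \<in> carrier \<Omega>"
  show "cocycle_hom k (\<phi> \<oplus>\<^bsub>\<Omega>\<^esub> \<psi>) = cocycle_hom k \<phi> \<oplus>\<^bsub>T\<^esub> cocycle_hom k \<psi>" if \<psi>: "\<psi> \<in> carrier \<Omega>" for \<psi>
    using \<phi> \<psi> \<Omega>_add[OF \<phi> \<psi>] pairing_add[OF cocycle_add[OF k], of \<phi> \<psi>] f
    by (simp add: cocycle_hom_def \<Omega>_simps smult_distrib_right)
  show "cocycle_hom k (a \<odot>\<^bsub>\<Omega>\<^esub> \<phi>) = a \<odot>\<^bsub>T\<^esub> cocycle_hom k \<phi>" if a: "a \<in> carrier A" for a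
    using \<phi> a \<Omega>_smult[OF a \<phi>] pairing_smult[OF cocycle_add[OF k] cocycle_mult[OF k], of \<phi> a] f
    by (simp add: cocycle_hom_def \<Omega>_simps smult_smult)
qed

lemma \<delta>_F: "x \<in> carrier A \<Longrightarrow> \<delta> x \<in> carrier F"
proof -
  have "e \<in> carrier S" using smult_1[OF e(1)] by (auto simp: char_module_carrier intro: rev_image_eqI[of 1])
  moreover assume "x \<in> carrier A"
  moreover have "finite {s. \<delta> x s \<noteq> \<zero>}" by (rule rev_finite_subset[of "{e}"]) auto
  ultimately show ?thesis by (auto simp: F_simps)
qed

lemma pairing_\<delta>: "k \<zero> = 0 \<Longrightarrow> pairing k (\<delta> x) = k x"
  by (subst pairing_superset[of "{e}"]) (auto simp: e)

lemma \<delta>_\<Omega>: "\<delta> p \<in> carrier \<Omega>" "\<delta> q \<in> carrier \<Omega>"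
  using pq \<delta>_F pairing_\<delta>[of \<epsilon>] additive_zero[OF \<epsilon>_add] by (auto simp: \<Omega>_simps)

lemma cocycle_hom_\<delta>: "k \<in> {g, h} \<Longrightarrow> x \<in> {p, q} \<Longrightarrow> cocycle_hom k (\<delta> x) = k x \<odot> f"
  using \<delta>_\<Omega> pairing_\<delta>[of k x] additive_zero[of k] cocycle_add[of k]
  by (auto simp: cocycle_hom_def)

text \<open>\<open>\<delta> x\<close> is x times the generator \<open>\<delta> \<one>\<close>, and
  both \<open>p\<close> and \<open>q\<close> annihilate \<open>T\<close> because
  \<open>\<eta> p = \<eta> q = 0\<close>.\<close>

lemma hom_F_\<delta>:
  assumes u: "u \<in> module_homs A F T" and x: "x \<in> {p, q}"
  shows "u (\<delta> x) = \<zero>"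
proof -
  have "\<delta> x = x \<odot>\<^bsub>F\<^esub> \<delta> \<one>" using x pq by (auto simp: F_simps)
  then have "u (\<delta> x) = x \<odot>\<^bsub>T\<^esub> u (\<delta> \<one>)"
    using u x pq \<delta>_F[OF one_closed] by (auto simp: module_homs_def)
  moreover have "u (\<delta> \<one>) \<in> carrier T"
    using u \<delta>_F[OF one_closed] by (auto simp: module_homs_def)
  ultimately show ?thesis using x pq f by (auto simp: smult_0 char_module_carrier)
qed

text \<open>A class spanning Ext would be represented by one homomorphism \<open>u\<close>. Some
  nonzero linear form in the values at \<open>\<delta> p\<close> and \<open>\<delta> q\<close> kills
  \<open>u\<close>. It also kills every homomorphism that extends to \<open>F\<close>, hence it
  kills all homomorphisms; but its values on the two dual cocycles are its own coefficients.\<close>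

lemma dim_Ext1_gt_1: "\<not> vs_dim (Ext1 A S T) \<le> 1"
proof
  assume "vs_dim (Ext1 A S T) \<le> 1"
  then obtain B where B: "finite B" "card B \<le> 1" "B \<subseteq> carrier (Ext1 A S T)"
    and span: "lin_span (Ext1 A S T) B = carrier (Ext1 A S T)"
    by (rule vs_dim_le_1E)
  let ?H = "hom_space A \<Omega> T"
  let ?HF = "hom_space A F T"
  let ?W = "(\<lambda>u. restrict u (carrier \<Omega>)) ` module_homs A F T"
  have H: "module scalars ?H" by (intro module_hom_space T \<Omega>_add \<Omega>_smult)
  have HF: "module scalars ?HF" by (intro module_hom_space T F_add F_smult)
  interpret H: module scalars ?H by (rule H)
  interpret HF: module scalars ?HF by (rule HF)
  have sub: "carrier \<Omega> \<subseteq> carrier F" by (auto simp: \<Omega>_simps)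
  have W: "submodule ?W scalars ?H"
  proof (rule submodule_scalarsI[OF H])
    have "restrict u (carrier \<Omega>) \<in> module_homs A \<Omega> T" if u: "u \<in> module_homs A F T" for u
      unfolding module_homs_def
    proof (intro CollectI conjI ballI)
      show "restrict u (carrier \<Omega>) \<in> carrier \<Omega> \<rightarrow>\<^sub>E carrier T"
        using u sub unfolding module_homs_def by auto
      fix \<phi> assume \<phi>: "\<phi> \<in> carrier \<Omega>"
      show "restrict u (carrier \<Omega>) (\<phi> \<oplus>\<^bsub>\<Omega>\<^esub> \<psi>)
          = restrict u (carrier \<Omega>) \<phi> \<oplus>\<^bsub>T\<^esub> restrict u (carrier \<Omega>) \<psi>" if \<psi>: "\<psi> \<in> carrier \<Omega>" for \<psi>
        using u subsetD[OF sub \<phi>] subsetD[OF sub \<psi>] \<phi> \<psi> \<Omega>_add[OF \<phi> \<psi>] unfolding module_homs_def by (auto simp: \<Omega>_simps(2))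
      show "restrict u (carrier \<Omega>) (a \<odot>\<^bsub>\<Omega>\<^esub> \<phi>) = a \<odot>\<^bsub>T\<^esub> restrict u (carrier \<Omega>) \<phi>"
        if a: "a \<in> carrier A" for a
        using u sub \<phi> a \<Omega>_smult[OF a \<phi>] unfolding module_homs_def by (auto simp: \<Omega>_simps(3))
    qed
    then show "?W \<subseteq> carrier ?H" by (auto simp: hom_space_def)
    have mem: "restrict u (carrier \<Omega>) \<in> ?W" if "u \<in> carrier ?HF" for u
      using that by (auto simp: hom_space_def)
    have "\<zero>\<^bsub>?H\<^esub> = restrict \<zero>\<^bsub>?HF\<^esub> (carrier \<Omega>)"
      using sub by (auto simp: hom_space_def intro!: ext)
    then show "\<zero>\<^bsub>?H\<^esub> \<in> ?W" using mem[OF HF.M.zero_closed] by simp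
    fix a assume "a \<in> ?W"
    then obtain u where u: "u \<in> carrier ?HF" "a = restrict u (carrier \<Omega>)"
      by (auto simp: hom_space_def)
    have "c \<odot>\<^bsub>?H\<^esub> a = restrict (c \<odot>\<^bsub>?HF\<^esub> u) (carrier \<Omega>)" for c
      using u sub by (auto simp: hom_space_def intro!: ext)
    then show "c \<odot>\<^bsub>?H\<^esub> a \<in> ?W" for c
      using mem[OF HF.smult_closed, of c u] u by simp
    fix b assume "b \<in> ?W"
    then obtain v where v: "v \<in> carrier ?HF" "b = restrict v (carrier \<Omega>)"
      by (auto simp: hom_space_def)
    have "a \<oplus>\<^bsub>?H\<^esub> b = restrict (u \<oplus>\<^bsub>?HF\<^esub> v) (carrier \<Omega>)"
      using u v sub by (auto simp: hom_space_def intro!: ext)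
    then show "a \<oplus>\<^bsub>?H\<^esub> b \<in> ?W"
      using mem[OF HF.M.a_closed, of u v] u v by simp
  qed
  interpret E: quotient_vector_space ?H ?W "Ext1 A S T"
    using H W by (intro quotient_vector_space.intro) (simp_all add: Ext1_def quot_module_def)
  \<comment> \<open>If the spanning set is empty, any homomorphism will do, since only the
    containment of \<open>B\<close> in one coset matters.\<close>
  obtain u where u: "u \<in> module_homs A \<Omega> T" "B \<subseteq> {?W +>\<^bsub>?H\<^esub> u}"
  proof (cases "B = {}")
    case True
    then show thesis using that cocycle_hom by blast
  next
    case False
    then obtain C where "B = {C}"
      using B(1,2) by (metis card_1_singletonE card_gt_0_iff le_less less_one not_gr_zero)
    then show thesis using that B(3) by (auto simp: E.carrier_quotient hom_space_def)
  qed
  have val: "\<exists>c. v (\<delta> x) = c \<odot> f" if "v \<in> module_homs A \<Omega> T" "x \<in> {p, q}" for v x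
    using that \<delta>_\<Omega> by (force simp: module_homs_def char_module_carrier)
  obtain b c where bc: "u (\<delta> p) = b \<odot> f" "u (\<delta> q) = c \<odot> f" using val[OF u(1), of p] val[OF u(1), of q] by blast
  \<comment> \<open>Coefficients of a nonzero linear form vanishing at (b, c).\<close>
  obtain x y where xy: "x * b + y * c = 0" "x \<noteq> 0 \<or> y \<noteq> 0"
  proof (cases "b = 0 \<and> c = 0")
    case True
    then show thesis using that[of 1 0] by simp
  next
    case False
    then show thesis using that[of c "- b"] by (auto simp: mult.commute)
  qed
  let ?U = "{v \<in> module_homs A \<Omega> T. x \<odot> v (\<delta> p) \<oplus> y \<odot> v (\<delta> q) = \<zero>}"
  have U: "submodule ?U scalars ?H"
  proof (rule submodule_scalarsI[OF H])
    have H_carrier: "carrier ?H = module_homs A \<Omega> T" by (simp add: hom_space_def)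
    show "?U \<subseteq> carrier ?H" by (auto simp: H_carrier)
    show "\<zero>\<^bsub>?H\<^esub> \<in> ?U"
      using H.M.zero_closed \<delta>_\<Omega> unfolding H_carrier by (simp add: hom_space_def smult_zero)
    fix v assume v: "v \<in> ?U"
    obtain k l where kl: "v (\<delta> p) = k \<odot> f" "v (\<delta> q) = l \<odot> f" using val v by blast
    show "d \<odot>\<^bsub>?H\<^esub> v \<in> ?U" for d
    proof -
      have "d \<odot>\<^bsub>?H\<^esub> v \<in> carrier ?H" using v H_carrier by (intro H.smult_closed) auto
      moreover have "x \<odot> (d \<odot>\<^bsub>?H\<^esub> v) (\<delta> p) \<oplus> y \<odot> (d \<odot>\<^bsub>?H\<^esub> v) (\<delta> q)
          = d \<odot> (x \<odot> v (\<delta> p) \<oplus> y \<odot> v (\<delta> q))"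
        using \<delta>_\<Omega> kl f \<eta>
        by (simp add: hom_space_def character_def smult_smult smult_distrib_left mult.left_commute
            mult.commute)
      ultimately show ?thesis using v H_carrier by (simp add: smult_zero)
    qed
    fix w assume w: "w \<in> ?U"
    obtain k' l' where kl': "w (\<delta> p) = k' \<odot> f" "w (\<delta> q) = l' \<odot> f" using val w by blast
    have "v \<oplus>\<^bsub>?H\<^esub> w \<in> carrier ?H" using v w H_carrier by (intro H.M.a_closed) auto
    moreover have "x \<odot> (v \<oplus>\<^bsub>?H\<^esub> w) (\<delta> p) \<oplus> y \<odot> (v \<oplus>\<^bsub>?H\<^esub> w) (\<delta> q)
          = (x \<odot> v (\<delta> p) \<oplus> y \<odot> v (\<delta> q)) \<oplus> (x \<odot> w (\<delta> p) \<oplus> y \<odot> w (\<delta> q))"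
      using \<delta>_\<Omega> kl kl' f
      by (simp add: hom_space_def smult_distrib_left smult_smult a_ac)
    ultimately show "v \<oplus>\<^bsub>?H\<^esub> w \<in> ?U" using v w H_carrier by simp
  qed
  \<comment> \<open>The image of \<open>?U\<close> in Ext is a subspace that contains the spanning
    class, so it is everything.\<close>
  have "?W +>\<^bsub>?H\<^esub> u \<in> (\<lambda>v. ?W +>\<^bsub>?H\<^esub> v) ` ?U"
    using u(1) xy(1) bc f by (auto simp: smult_smult smult_distrib_right[symmetric] smult_0)
  then have "carrier (Ext1 A S T) \<subseteq> (\<lambda>v. ?W +>\<^bsub>?H\<^esub> v) ` ?U"
    unfolding span[symmetric] using u(2) by (intro lin_span_least E.submodule_quotient U) auto
  \<comment> \<open>A coset only determines \<open>v\<close> up to the restriction of a homomorphism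
    on \<open>F\<close>. Such a restriction vanishes at \<open>\<delta> p\<close> and
    \<open>\<delta> q\<close>, so the linear form is the same on \<open>v\<close> and on the
    representative taken from \<open>?U\<close>.\<close>
  then have all: "x \<odot> v (\<delta> p) \<oplus> y \<odot> v (\<delta> q) = \<zero>" if v: "v \<in> module_homs A \<Omega> T" for v
  proof -
    have v': "v \<in> carrier ?H" using v by (simp add: hom_space_def)
    then have "?W +>\<^bsub>?H\<^esub> v \<in> (\<lambda>v. ?W +>\<^bsub>?H\<^esub> v) ` ?U"
      using \<open>carrier (Ext1 A S T) \<subseteq> _\<close> by (auto simp: E.carrier_quotient)
    then obtain w where w: "w \<in> ?U" "?W +>\<^bsub>?H\<^esub> v = ?W +>\<^bsub>?H\<^esub> w" by auto
    have w': "w \<in> carrier ?H" using w(1) by (simp add: hom_space_def)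
    have "v \<in> ?W +>\<^bsub>?H\<^esub> w" using E.W.a_rcos_self[OF v'] w(2) by simp
    then obtain z where z: "z \<in> module_homs A F T" "v = restrict z (carrier \<Omega>) \<oplus>\<^bsub>?H\<^esub> w"
      by (auto simp: a_r_coset_def r_coset_def)
    have "v (\<delta> t) = w (\<delta> t)" if "t \<in> {p, q}" for t
      using z that \<delta>_\<Omega> hom_F_\<delta>[OF z(1) that] val[of w t] w(1) f
      by (auto simp: hom_space_def)
    then show ?thesis using w(1) by simp
  qed
  have "x = 0"
    using all[OF cocycle_hom, of g] f cocycle_hom_\<delta>[of g] dual
    by (simp add: smult_0 smult_zero smult_1 smult_f_eq_zero_iff)
  moreover have "y = 0"
    using all[OF cocycle_hom, of h] f cocycle_hom_\<delta>[of h] dual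
    by (simp add: smult_0 smult_zero smult_1 smult_f_eq_zero_iff)
  ultimately show False using xy(2) by simp
qed

end

section \<open>Path algebras\<close>

lemma path_algebra_simps:
  "carrier (path_algebra Q) = {f. finite {p. f p \<noteq> 0} \<and> {p. f p \<noteq> 0} \<subseteq> paths Q}"
  "\<zero>\<^bsub>path_algebra Q\<^esub> = (\<lambda>p. 0)"
  "\<one>\<^bsub>path_algebra Q\<^esub> = (\<lambda>p. if p \<in> vertex_path ` verts Q then 1 else 0)"
  "f \<oplus>\<^bsub>path_algebra Q\<^esub> g = (\<lambda>p. f p + g p)"
  "c \<odot>\<^bsub>path_algebra Q\<^esub> f = (\<lambda>p. c * f p)"
  "f \<otimes>\<^bsub>path_algebra Q\<^esub> g = (\<lambda>p. \<Sum>(q, r)\<in>factorizations Q p. f q * g r)"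
  by (simp_all add: path_algebra_def)

lemma path_algebra_outside: "f \<in> carrier (path_algebra Q) \<Longrightarrow> p \<notin> paths Q \<Longrightarrow> f p = 0"
  by (auto simp: path_algebra_simps)

lemma factorizations_iff:
  "((u, es, w), (w', fs, v)) \<in> factorizations Q p \<longleftrightarrow>
    (u, es, w) \<in> paths Q \<and> (w', fs, v) \<in> paths Q \<and> w = w' \<and> p = (u, es @ fs, v)"
  by (auto simp: factorizations_def)

lemma mult_nonzeroE:
  assumes "(f \<otimes>\<^bsub>path_algebra Q\<^esub> g) p \<noteq> 0"
  obtains q r where "(q, r) \<in> factorizations Q p" "f q \<noteq> 0" "g r \<noteq> 0"
proof -
  have "(\<Sum>(q, r)\<in>factorizations Q p. f q * g r) \<noteq> 0"
    using assms by (simp add: path_algebra_simps)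
  then obtain x where "x \<in> factorizations Q p" "(case x of (q, r) \<Rightarrow> f q * g r) \<noteq> 0"
    by (rule sum.not_neutral_contains_not_neutral)
  then show thesis using that by (cases x) auto
qed

lemma path_elem_carrier: "p \<in> paths Q \<Longrightarrow> path_elem p \<in> carrier (path_algebra Q)"
  by (auto simp: path_algebra_simps path_elem_def)

lemma arrow_ideal_power_iff:
  "f \<in> arrow_ideal_power Q m \<longleftrightarrow>
    f \<in> carrier (path_algebra Q) \<and> (\<forall>p. f p \<noteq> 0 \<longrightarrow> m \<le> path_length p)"
  by (simp add: arrow_ideal_power_def)

text \<open>Peeling one path at a time off the finite support reduces linear claims to multiples of
  a single path.\<close>

lemma arrow_ideal_power_induct [consumes 1, case_names zero add path]:
  assumes f: "f \<in> arrow_ideal_power Q m"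
    and zero: "P \<zero>\<^bsub>path_algebra Q\<^esub>"
    and add: "\<And>f g. \<lbrakk>f \<in> arrow_ideal_power Q m; g \<in> arrow_ideal_power Q m; P f; P g\<rbrakk>
        \<Longrightarrow> P (f \<oplus>\<^bsub>path_algebra Q\<^esub> g)"
    and path: "\<And>c p. \<lbrakk>p \<in> paths Q; m \<le> path_length p\<rbrakk>
        \<Longrightarrow> P (c \<odot>\<^bsub>path_algebra Q\<^esub> path_elem p)"
  shows "P f"
proof -
  have "finite {p. f p \<noteq> 0}" using f by (simp add: arrow_ideal_power_iff path_algebra_simps)
  then show ?thesis using f
  proof (induction "{p. f p \<noteq> 0}" arbitrary: f rule: finite_induct)
    case empty
    then have "f = \<zero>\<^bsub>path_algebra Q\<^esub>" by (auto simp: path_algebra_simps)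
    then show ?case using zero by simp
  next
    case (insert p B)
    let ?g = "f(p := 0)"
    have B: "B = {q. ?g q \<noteq> 0}" using insert.hyps by auto
    have p: "f p \<noteq> 0" using insert.hyps by auto
    have "?g \<in> arrow_ideal_power Q m"
      using insert.prems insert.hyps(1) unfolding B
      by (auto simp: arrow_ideal_power_iff path_algebra_simps)
    moreover have "P ?g" using insert.hyps(3)[OF B] calculation .
    moreover have pp: "p \<in> paths Q" "m \<le> path_length p"
      using p insert.prems by (cases p, auto simp: arrow_ideal_power_iff path_algebra_simps)+
    moreover have "f p \<odot>\<^bsub>path_algebra Q\<^esub> path_elem p \<in> arrow_ideal_power Q m"
      using pp by (auto simp: arrow_ideal_power_iff path_algebra_simps path_elem_def)
    ultimately have "P (?g \<oplus>\<^bsub>path_algebra Q\<^esub> f p \<odot>\<^bsub>path_algebra Q\<^esub> path_elem p)"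
      using add path by blast
    moreover have "?g \<oplus>\<^bsub>path_algebra Q\<^esub> f p \<odot>\<^bsub>path_algebra Q\<^esub> path_elem p = f"
      by (auto simp: path_algebra_simps path_elem_def)
    ultimately show ?case by simp
  qed
qed

lemma carrier_eq_arrow_ideal_power_0: "carrier (path_algebra Q) = arrow_ideal_power Q 0"
  by (auto simp: arrow_ideal_power_iff)

section \<open>Products in the path algebra of a finite quiver\<close>

context fin_digraph
begin

lemma paths_Nil_iff: "(u, [], v) \<in> paths G \<longleftrightarrow> u = v \<and> u \<in> verts G"
  by (auto simp: paths_def awalk_Nil_iff)

lemma vertex_path_in_paths: "v \<in> verts G \<Longrightarrow> vertex_path v \<in> paths G"
  by (simp add: vertex_path_def paths_Nil_iff)

lemma paths_Cons_iff:
  "(u, e # es, v) \<in> paths G \<longleftrightarrow> e \<in> arcs G \<and> u = tail G e \<and> (head G e, es, v) \<in> paths G"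
  by (auto simp: paths_def awalk_Cons_iff)

lemma arrow_path_in_paths: "a \<in> arcs G \<Longrightarrow> arrow_path G a \<in> paths G"
  by (simp add: arrow_path_def paths_Cons_iff paths_Nil_iff)

lemma paths_append: "\<lbrakk>(u, es, w) \<in> paths G; (w, fs, v) \<in> paths G\<rbrakk> \<Longrightarrow> (u, es @ fs, v) \<in> paths G"
  unfolding paths_def by (auto intro: awalk_appendI simp del: awalk_append_iff)

text \<open>A factorization is determined by the position of the cut, because the middle vertex is
  the end of the initial piece. Finiteness matters since a sum over an infinite set would be
  0.\<close>

lemma finite_factorizations: "finite (factorizations G p)"
proof -
  obtain u l v where p: "p = (u, l, v)" by (cases p) auto
  have "factorizations G p \<subseteq> (\<lambda>n. ((u, take n l, awlast u (take n l)),
      (awlast u (take n l), drop n l, v))) ` {..length l}"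
  proof
    fix x assume "x \<in> factorizations G p"
    then obtain es w fs where x: "x = ((u, es, w), (w, fs, v))" "l = es @ fs" "awalk u es w"
      by (auto simp: factorizations_def p paths_def)
    then have "awlast u es = w" by auto
    then show "x \<in> (\<lambda>n. ((u, take n l, awlast u (take n l)),
        (awlast u (take n l), drop n l, v))) ` {..length l}"
      using x by (intro image_eqI[of _ _ "length es"]) auto
  qed
  then show ?thesis by (rule finite_subset) simp
qed

lemma factorizations_outside: "p \<notin> paths G \<Longrightarrow> factorizations G p = {}"
  using paths_append by (fastforce simp: factorizations_def)

lemma factorizations_vertex:
  "v \<in> verts G \<Longrightarrow> factorizations G (vertex_path v) = {(vertex_path v, vertex_path v)}"
  by (auto simp: factorizations_def vertex_path_def paths_Nil_iff)

lemma factorizations_arrow: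
  assumes "a \<in> arcs G"
  shows "factorizations G (arrow_path G a) =
    {(vertex_path (tail G a), arrow_path G a), (arrow_path G a, vertex_path (head G a))}"
  using assms
  by (auto simp: factorizations_def vertex_path_def arrow_path_def paths_Nil_iff paths_Cons_iff
      append_eq_Cons_conv Cons_eq_append_conv)

lemma mult_coeff_vertex:
  "v \<in> verts G \<Longrightarrow>
    (f \<otimes>\<^bsub>path_algebra G\<^esub> g) (vertex_path v) = f (vertex_path v) * g (vertex_path v)"
  by (simp add: path_algebra_simps factorizations_vertex)

text \<open>This is the cocycle identity for the coefficient of an arrow, with the vertex
  coefficient at the tail acting from the left and the one at the head from the right.\<close>

lemma mult_coeff_arrow:
  "a \<in> arcs G \<Longrightarrow> (f \<otimes>\<^bsub>path_algebra G\<^esub> g) (arrow_path G a) =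
    f (arrow_path G a) * g (vertex_path (head G a)) + f (vertex_path (tail G a)) * g (arrow_path G a)"
  by (simp add: path_algebra_simps factorizations_arrow)
    (simp add: arrow_path_def vertex_path_def)

lemma vertex_mult:
  assumes u: "u \<in> verts G" and f: "f \<in> carrier (path_algebra G)"
  shows "path_elem (vertex_path u) \<otimes>\<^bsub>path_algebra G\<^esub> f = (\<lambda>p. if fst p = u then f p else 0)"
proof
  fix p :: "('a, 'b) qpath"
  show "(path_elem (vertex_path u) \<otimes>\<^bsub>path_algebra G\<^esub> f) p = (if fst p = u then f p else 0)"
  proof (cases "p \<in> paths G")
    case False
    then show ?thesis
      using path_algebra_outside[OF f] by (simp add: path_algebra_simps factorizations_outside)
  next
    case True
    \<comment> \<open>Only the factorization that splits off the trivial path at \<open>u\<close>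
      can contribute, so the sum is rewritten with a Kronecker delta.\<close>
    have *: "(\<Sum>(q, r)\<in>factorizations G p. path_elem (vertex_path u) q * f r)
        = (\<Sum>x\<in>factorizations G p. if x = (vertex_path u, p) then f p else 0)"
      by (intro sum.cong) (auto simp: factorizations_def path_elem_def vertex_path_def split: if_splits)
    have "(vertex_path u, p) \<in> factorizations G p \<longleftrightarrow> fst p = u"
      using u True by (cases p) (auto simp: factorizations_iff vertex_path_def paths_Nil_iff)
    then show ?thesis
      unfolding path_algebra_simps * by (simp add: finite_factorizations)
  qed
qed

lemma mult_vertex:
  assumes u: "u \<in> verts G" and f: "f \<in> carrier (path_algebra G)"
  shows "f \<otimes>\<^bsub>path_algebra G\<^esub> path_elem (vertex_path u) = (\<lambda>p. if snd (snd p) = u then f p else 0)"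
proof
  fix p :: "('a, 'b) qpath"
  show "(f \<otimes>\<^bsub>path_algebra G\<^esub> path_elem (vertex_path u)) p = (if snd (snd p) = u then f p else 0)"
  proof (cases "p \<in> paths G")
    case False
    then show ?thesis
      using path_algebra_outside[OF f] by (simp add: path_algebra_simps factorizations_outside)
  next
    case True
    have *: "(\<Sum>(q, r)\<in>factorizations G p. f q * path_elem (vertex_path u) r)
        = (\<Sum>x\<in>factorizations G p. if x = (p, vertex_path u) then f p else 0)"
      by (intro sum.cong) (auto simp: factorizations_def path_elem_def vertex_path_def split: if_splits)
    have "(p, vertex_path u) \<in> factorizations G p \<longleftrightarrow> snd (snd p) = u"
      using u True by (cases p) (auto simp: factorizations_iff vertex_path_def paths_Nil_iff)
    then show ?thesis
      unfolding path_algebra_simps * by (simp add: finite_factorizations)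
  qed
qed

lemma path_elem_mult:
  assumes "(u, es, w) \<in> paths G" "(w, fs, v) \<in> paths G"
  shows "path_elem (u, es, w) \<otimes>\<^bsub>path_algebra G\<^esub> path_elem (w, fs, v)
    = (path_elem (u, es @ fs, v) :: _ \<Rightarrow> 'k::field)"
proof
  fix p :: "('a, 'b) qpath"
  have "(\<Sum>(q, r)\<in>factorizations G p. path_elem (u, es, w) q * (path_elem (w, fs, v) r :: 'k))
      = (\<Sum>x\<in>factorizations G p. if x = ((u, es, w), (w, fs, v)) then 1 else 0)"
    by (intro sum.cong) (auto simp: path_elem_def split: if_splits)
  then show "(path_elem (u, es, w) \<otimes>\<^bsub>path_algebra G\<^esub> path_elem (w, fs, v)) p
      = (path_elem (u, es @ fs, v) p :: 'k)"
    using assms by (simp add: path_algebra_simps finite_factorizations factorizations_iff path_elem_def)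
qed

text \<open>Lengths add up along a factorization. The closure premise is discharged later from the
  ring structure, which arrives together with the ideal \<open>I\<close>.\<close>

lemma arrow_ideal_power_mult:
  assumes f: "f \<in> arrow_ideal_power G i" and g: "g \<in> arrow_ideal_power G j"
    and fg: "f \<otimes>\<^bsub>path_algebra G\<^esub> g \<in> carrier (path_algebra G)"
  shows "f \<otimes>\<^bsub>path_algebra G\<^esub> g \<in> arrow_ideal_power G (i + j)"
  unfolding arrow_ideal_power_iff
proof (intro conjI allI impI fg)
  fix p assume "(f \<otimes>\<^bsub>path_algebra G\<^esub> g) p \<noteq> 0"
  then obtain q r where "(q, r) \<in> factorizations G p" "f q \<noteq> 0" "g r \<noteq> 0"
    by (rule mult_nonzeroE)
  then show "i + j \<le> path_length p"
    using f g by (fastforce simp: arrow_ideal_power_iff factorizations_def path_length_def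
        intro: add_mono)
qed

end

section \<open>Bound quiver algebras\<close>

locale bound_quiver = fin_digraph Q for Q :: "('v, 'e) pre_digraph" +
  fixes I :: "(('v, 'e) qpath \<Rightarrow> 'k::field) set"
  assumes admissible: "admissible_ideal Q I"
begin

abbreviation R :: "('k, ('v, 'e) qpath \<Rightarrow> 'k) module" where "R \<equiv> path_algebra Q"
abbreviation A :: "('k, ('v, 'e, 'k) bqa_elem) module" where "A \<equiv> bound_quiver_algebra Q I"
abbreviation cls :: "(('v, 'e) qpath \<Rightarrow> 'k) \<Rightarrow> ('v, 'e, 'k) bqa_elem" where "cls \<equiv> bqa_class Q I"
abbreviation vx :: "'v \<Rightarrow> ('v, 'e, 'k) bqa_elem" where "vx v \<equiv> cls (path_elem (vertex_path v))"
abbreviation ar :: "'e \<Rightarrow> ('v, 'e, 'k) bqa_elem" where "ar a \<equiv> cls (path_elem (arrow_path Q a))"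

text \<open>The locale \<open>ideal\<close> includes \<open>ring\<close>, so this is also the source
  of the ring axioms for the path algebra.\<close>

sublocale I: ideal I R
  using admissible by (simp add: admissible_ideal_def)

lemma R_zero_closed: "\<zero>\<^bsub>R\<^esub> \<in> carrier R"
  and R_add_closed: "\<lbrakk>f \<in> carrier R; g \<in> carrier R\<rbrakk> \<Longrightarrow> f \<oplus>\<^bsub>R\<^esub> g \<in> carrier R"
  using ring.ring_simprules(1,2)[OF I.ring_axioms] by auto

lemma I_le_arrow_ideal_power_2: "I \<subseteq> arrow_ideal_power Q 2"
  using admissible by (simp add: admissible_ideal_def)

lemma obtain_nilpotency:
  obtains m where "2 \<le> m" "arrow_ideal_power Q m \<subseteq> I"
  using admissible by (auto simp: admissible_ideal_def)

lemma module_R: "module scalars R"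
proof (intro module_scalarsI I.is_abelian_group)
  fix c f assume "f \<in> carrier R"
  then show "c \<odot>\<^bsub>R\<^esub> f \<in> carrier R"
    by (auto simp: path_algebra_simps intro: rev_finite_subset[of "{p. f p \<noteq> 0}"])
qed (auto simp: path_algebra_simps algebra_simps)

sublocale R: kalgebra R
proof (intro kalgebra.intro kalgebra_axioms.intro module_R I.ring_axioms)
  fix f g c
  show "c \<odot>\<^bsub>R\<^esub> f \<otimes>\<^bsub>R\<^esub> g = c \<odot>\<^bsub>R\<^esub> (f \<otimes>\<^bsub>R\<^esub> g)"
    by (auto simp: path_algebra_simps sum_distrib_left case_prod_unfold mult.assoc)
  show "f \<otimes>\<^bsub>R\<^esub> (c \<odot>\<^bsub>R\<^esub> g) = c \<odot>\<^bsub>R\<^esub> (f \<otimes>\<^bsub>R\<^esub> g)"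
    by (auto simp: path_algebra_simps sum_distrib_left case_prod_unfold mult.left_commute)
qed

text \<open>A ring ideal is a subspace because c f = (c 1) f.\<close>

lemma submodule_I: "submodule I scalars R"
proof (rule submodule_scalarsI[OF module_R I.a_subset])
  show "\<zero>\<^bsub>R\<^esub> \<in> I" by simp
  show "f \<oplus>\<^bsub>R\<^esub> g \<in> I" if "f \<in> I" "g \<in> I" for f g using that by simp
  show "c \<odot>\<^bsub>R\<^esub> f \<in> I" if f: "f \<in> I" for c f
  proof -
    have "c \<odot>\<^bsub>R\<^esub> f = (c \<odot>\<^bsub>R\<^esub> \<one>\<^bsub>R\<^esub>) \<otimes>\<^bsub>R\<^esub> f"
      using I.a_Hcarr[OF f] by (simp add: R.smult_mult_left)
    then show ?thesis using I.I_l_closed[OF f, of "c \<odot>\<^bsub>R\<^esub> \<one>\<^bsub>R\<^esub>"] by simp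
  qed
qed

sublocale QV: quotient_vector_space R I A
  using module_R submodule_I
  by (intro quotient_vector_space.intro)
    (simp_all add: bound_quiver_algebra_def quot_algebra_def FactRing_def)

lemma carrier_A: "carrier A = cls ` carrier R"
  unfolding bqa_class_def by (rule QV.carrier_quotient)

lemma cls_closed: "f \<in> carrier R \<Longrightarrow> cls f \<in> carrier A"
  by (simp add: carrier_A)

lemma cls_add: "\<lbrakk>f \<in> carrier R; g \<in> carrier R\<rbrakk> \<Longrightarrow> cls (f \<oplus>\<^bsub>R\<^esub> g) = cls f \<oplus>\<^bsub>A\<^esub> cls g"
  unfolding bqa_class_def by (simp add: QV.add_quotient)

lemma cls_smult: "f \<in> carrier R \<Longrightarrow> cls (c \<odot>\<^bsub>R\<^esub> f) = c \<odot>\<^bsub>A\<^esub> cls f"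
  unfolding bqa_class_def by (simp add: QV.smult_quotient)

lemma cls_mult: "\<lbrakk>f \<in> carrier R; g \<in> carrier R\<rbrakk> \<Longrightarrow> cls (f \<otimes>\<^bsub>R\<^esub> g) = cls f \<otimes>\<^bsub>A\<^esub> cls g"
  unfolding bqa_class_def
  by (simp add: bound_quiver_algebra_def quot_algebra_def FactRing_def I.rcoset_mult_add)

lemma cls_one: "cls \<one>\<^bsub>R\<^esub> = \<one>\<^bsub>A\<^esub>"
  by (simp add: bqa_class_def bound_quiver_algebra_def quot_algebra_def FactRing_def)

lemma cls_zero: "cls \<zero>\<^bsub>R\<^esub> = \<zero>\<^bsub>A\<^esub>"
  unfolding bqa_class_def by (rule QV.zero_quotient[symmetric])

lemma cls_eq_zero_iff: "f \<in> carrier R \<Longrightarrow> cls f = \<zero>\<^bsub>A\<^esub> \<longleftrightarrow> f \<in> I"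
  unfolding bqa_class_def by (rule QV.coset_eq_zero_iff)

lemmas cls_hom = cls_add[symmetric] cls_smult[symmetric] cls_mult[symmetric]

sublocale A: kalgebra A
proof (intro kalgebra.intro kalgebra_axioms.intro QV.module_quotient ringI QV.abelian_group_quotient
    monoidI)
  show "\<one>\<^bsub>A\<^esub> \<in> carrier A" using cls_closed[of "\<one>\<^bsub>R\<^esub>"] by (simp add: cls_one)
  fix x assume "x \<in> carrier A"
  then obtain f where f: "f \<in> carrier R" "x = cls f" by (auto simp: carrier_A)
  show "\<one>\<^bsub>A\<^esub> \<otimes>\<^bsub>A\<^esub> x = x" "x \<otimes>\<^bsub>A\<^esub> \<one>\<^bsub>A\<^esub> = x"
    using f by (simp_all add: cls_one[symmetric] cls_mult[symmetric])
  fix y assume "y \<in> carrier A"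
  then obtain g where g: "g \<in> carrier R" "y = cls g" by (auto simp: carrier_A)
  show "x \<otimes>\<^bsub>A\<^esub> y \<in> carrier A"
    using f g by (simp add: cls_hom cls_closed)
  show "(c \<odot>\<^bsub>A\<^esub> x) \<otimes>\<^bsub>A\<^esub> y = c \<odot>\<^bsub>A\<^esub> (x \<otimes>\<^bsub>A\<^esub> y)" "x \<otimes>\<^bsub>A\<^esub> (c \<odot>\<^bsub>A\<^esub> y) = c \<odot>\<^bsub>A\<^esub> (x \<otimes>\<^bsub>A\<^esub> y)" for c
    using f g by (simp_all add: cls_hom R.smult_mult_left R.smult_mult_right)
  fix z assume "z \<in> carrier A"
  then obtain h where h: "h \<in> carrier R" "z = cls h" by (auto simp: carrier_A)
  show "x \<otimes>\<^bsub>A\<^esub> y \<otimes>\<^bsub>A\<^esub> z = x \<otimes>\<^bsub>A\<^esub> (y \<otimes>\<^bsub>A\<^esub> z)"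
    "(x \<oplus>\<^bsub>A\<^esub> y) \<otimes>\<^bsub>A\<^esub> z = x \<otimes>\<^bsub>A\<^esub> z \<oplus>\<^bsub>A\<^esub> y \<otimes>\<^bsub>A\<^esub> z"
    "z \<otimes>\<^bsub>A\<^esub> (x \<oplus>\<^bsub>A\<^esub> y) = z \<otimes>\<^bsub>A\<^esub> x \<oplus>\<^bsub>A\<^esub> z \<otimes>\<^bsub>A\<^esub> y"
    using f g h by (simp_all add: cls_hom I.m_assoc I.l_distr I.r_distr)
qed

lemma vx_closed: "v \<in> verts Q \<Longrightarrow> vx v \<in> carrier A"
  by (intro cls_closed path_elem_carrier vertex_path_in_paths)

lemma ar_closed: "a \<in> arcs Q \<Longrightarrow> ar a \<in> carrier A"
  by (intro cls_closed path_elem_carrier arrow_path_in_paths)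

lemma vx_mult:
  assumes "u \<in> verts Q" "v \<in> verts Q"
  shows "vx u \<otimes>\<^bsub>A\<^esub> vx v = (if u = v then vx u else \<zero>\<^bsub>A\<^esub>)"
proof -
  have "path_elem (vertex_path u) \<otimes>\<^bsub>R\<^esub> path_elem (vertex_path v)
      = (if u = v then path_elem (vertex_path u) else \<zero>\<^bsub>R\<^esub>)"
    unfolding vertex_mult[OF assms(1) path_elem_carrier[OF vertex_path_in_paths[OF assms(2)]]]
    by (auto simp: path_elem_def vertex_path_def path_algebra_simps(2))
  then show ?thesis
    using assms by (simp add: cls_hom path_elem_carrier vertex_path_in_paths cls_zero)
qed

lemma sum_vx: "finsum A vx (verts Q) = \<one>\<^bsub>A\<^esub>"
proof -
  \<comment> \<open>The partial sum over \<open>V\<close> is tracked by an explicit representative,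
    the indicator of the trivial paths at \<open>V\<close>; for all vertices this is the identity of
    the path algebra.\<close>
  have "finsum A vx V = cls (\<lambda>p. if p \<in> vertex_path ` V then 1 else 0)
      \<and> (\<lambda>p. if p \<in> vertex_path ` V then 1 else 0) \<in> carrier R"
    if "finite V" "V \<subseteq> verts Q" for V
    using that
  proof (induction V rule: finite_induct)
    case empty
    then show ?case using cls_zero R_zero_closed by (simp add: path_algebra_simps(2))
  next
    case (insert v V)
    let ?f = "\<lambda>p. if p \<in> vertex_path ` V then (1::'k) else 0"
    have f: "?f \<in> carrier R" "finsum A vx V = cls ?f" using insert by auto
    have "(\<lambda>p. if p \<in> vertex_path ` insert v V then 1 else 0) = path_elem (vertex_path v) \<oplus>\<^bsub>R\<^esub> ?f"
      using insert.hyps by (auto simp: path_algebra_simps(4) path_elem_def vertex_path_def fun_eq_iff)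
    moreover have "path_elem (vertex_path v) \<in> carrier R"
      using insert.prems by (intro path_elem_carrier vertex_path_in_paths) auto
    moreover have "finsum A vx (insert v V) = vx v \<oplus>\<^bsub>A\<^esub> finsum A vx V"
      using insert vx_closed by (intro A.finsum_insert) auto
    ultimately show ?case using f by (simp add: cls_add)
  qed
  from this[OF finite_verts order_refl] show ?thesis
    by (simp add: cls_one[symmetric] path_algebra_simps(3))
qed

section \<open>Coefficients of short paths and parallel arrows\<close>

text \<open>The coefficient of a path of length at most 1 does not depend on the representative.\<close>

definition coeff :: "('v, 'e) qpath \<Rightarrow> ('v, 'e, 'k) bqa_elem \<Rightarrow> 'k" where
  "coeff p x = (SOME f. f \<in> x) p"

lemma coeff_cls:
  assumes f: "f \<in> carrier R" and p: "path_length p < 2"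
  shows "coeff p (cls f) = f p"
proof -
  define g where "g = (SOME g. g \<in> cls f)"
  have "f \<in> cls f" unfolding bqa_class_def using f by (rule I.a_rcos_self)
  then have "g \<in> cls f" unfolding g_def by (rule someI[of "\<lambda>g. g \<in> cls f"])
  then obtain i where "i \<in> I" "g = i \<oplus>\<^bsub>R\<^esub> f"
    by (auto simp: bqa_class_def a_r_coset_def r_coset_def)
  \<comment> \<open>\<open>I\<close> lies in the span of the paths of length at least 2, so the
    chosen representative \<open>g\<close> agrees with \<open>f\<close> at the short path
    \<open>p\<close>.\<close>
  moreover from \<open>i \<in> I\<close> have "i p = 0"
    using I_le_arrow_ideal_power_2 p unfolding arrow_ideal_power_iff subset_iff by (meson leD)
  ultimately show ?thesis by (simp add: coeff_def g_def[symmetric] path_algebra_simps(4))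
qed

lemma length_short [simp]: "path_length (vertex_path v) = 0" "path_length (arrow_path Q a) = 1"
  by (simp_all add: path_length_def vertex_path_def arrow_path_def)

lemma character_coeff_vertex:
  assumes v: "v \<in> verts Q"
  shows "A.character (coeff (vertex_path v))"
  unfolding A.character_def
proof (intro conjI ballI allI)
  show "coeff (vertex_path v) \<one>\<^bsub>A\<^esub> = 1"
    using v by (simp add: cls_one[symmetric] coeff_cls) (simp add: path_algebra_simps)
  fix x assume "x \<in> carrier A"
  then obtain f where f: "f \<in> carrier R" "x = cls f" by (auto simp: carrier_A)
  show "coeff (vertex_path v) (c \<odot>\<^bsub>A\<^esub> x) = c * coeff (vertex_path v) x" for c
    using f by (simp add: cls_hom coeff_cls) (simp add: path_algebra_simps)
  fix y assume "y \<in> carrier A"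
  then obtain g where g: "g \<in> carrier R" "y = cls g" by (auto simp: carrier_A)
  show "coeff (vertex_path v) (x \<oplus>\<^bsub>A\<^esub> y) = coeff (vertex_path v) x + coeff (vertex_path v) y"
    using f g by (simp add: cls_hom coeff_cls) (simp add: path_algebra_simps)
  show "coeff (vertex_path v) (x \<otimes>\<^bsub>A\<^esub> y) = coeff (vertex_path v) x * coeff (vertex_path v) y"
    using f g v by (simp add: cls_hom coeff_cls mult_coeff_vertex)
qed

text \<open>With paths composed from left to right, the cocycle identity places the tail character
  on the left and the head character on the right. Hence \<open>S\<close> is the simple module at
  the head and \<open>T\<close> the one at the tail. The coefficients of two distinct parallel
  arrows share these characters and are dual to the two arrow classes.\<close>

lemma no_parallel_arrows:
  assumes ext: "\<And>(S :: (('v, 'e, 'k) bqa_elem, ('v, 'e, 'k) bqa_elem) module)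
               (T :: (('v, 'e, 'k) bqa_elem, ('v, 'e, 'k) bqa_elem) module).
                simple_module A S \<Longrightarrow> simple_module A T \<Longrightarrow> vs_dim (Ext1 A S T) \<le> 1"
    and a: "a \<in> arcs Q" and b: "b \<in> arcs Q"
    and par: "tail Q a = tail Q b" "head Q a = head Q b"
  shows "a = b"
proof (rule ccontr)
  assume ab: "a \<noteq> b"
  let ?u = "tail Q a" and ?v = "head Q a"
  have u: "?u \<in> verts Q" and v: "?v \<in> verts Q" using a by simp_all
  note pe = path_elem_carrier arrow_path_in_paths vertex_path_in_paths
  interpret two_cocycles A "coeff (vertex_path ?v)" "coeff (vertex_path ?u)" "vx ?v" "vx ?u"
    "coeff (arrow_path Q a)" "coeff (arrow_path Q b)" "ar a" "ar b"
  proof (intro two_cocycles.intro two_cocycles_axioms.intro A.kalgebra_axioms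
      character_coeff_vertex u v vx_closed ar_closed a b)
    fix k x y assume k: "k \<in> {coeff (arrow_path Q a), coeff (arrow_path Q b)}"
      and "x \<in> carrier A" "y \<in> carrier A"
    then obtain f g where fg: "f \<in> carrier R" "x = cls f" "g \<in> carrier R" "y = cls g"
      by (auto simp: carrier_A)
    from k obtain c where c: "k = coeff (arrow_path Q c)" "c \<in> arcs Q" "tail Q c = ?u" "head Q c = ?v"
      using a b par by auto
    show "k (x \<oplus>\<^bsub>A\<^esub> y) = k x + k y"
      using fg c by (simp add: cls_hom coeff_cls) (simp add: path_algebra_simps)
    show "k (x \<otimes>\<^bsub>A\<^esub> y) = k x * coeff (vertex_path ?v) y + coeff (vertex_path ?u) x * k y"
      using fg c by (simp add: cls_hom coeff_cls mult_coeff_arrow)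
  qed (use a b u v ab in \<open>simp_all add: coeff_cls pe\<close>,
      simp_all add: path_elem_def arrow_path_def vertex_path_def)
  show False
    using dim_Ext1_gt_1 ext A.simple_char_module[OF \<epsilon> e] A.simple_char_module[OF \<eta> f] by blast
qed

section \<open>The filtration of the derivations by powers of the radical\<close>

text \<open>The \<open>i\<close>-th power of the radical of \<open>A\<close>, as the image of the
  paths of length at least \<open>i\<close>; \<open>J 0\<close> is all of \<open>A\<close>, and
  admissibility makes \<open>J m\<close> zero for large \<open>m\<close>.\<close>

definition J :: "nat \<Rightarrow> ('v, 'e, 'k) bqa_elem set" where
  "J i = cls ` arrow_ideal_power Q i"

lemma submodule_arrow_ideal_power: "submodule (arrow_ideal_power Q i) scalars R"
proof (rule submodule_scalarsI[OF module_R])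
  show "arrow_ideal_power Q i \<subseteq> carrier R" by (auto simp: arrow_ideal_power_iff)
  show "\<zero>\<^bsub>R\<^esub> \<in> arrow_ideal_power Q i"
    using R_zero_closed by (simp add: arrow_ideal_power_iff) (simp add: path_algebra_simps)
  fix f :: "('v, 'e) qpath \<Rightarrow> 'k" assume f: "f \<in> arrow_ideal_power Q i"
  show "c \<odot>\<^bsub>R\<^esub> f \<in> arrow_ideal_power Q i" for c
    using f R.smult_closed'[of f c]
    by (simp add: arrow_ideal_power_iff) (simp add: path_algebra_simps)
  fix g :: "('v, 'e) qpath \<Rightarrow> 'k" assume g: "g \<in> arrow_ideal_power Q i"
  have "i \<le> path_length p" if "f p + g p \<noteq> 0" for p
    using that f g unfolding arrow_ideal_power_iff by (metis add_0)
  then show "f \<oplus>\<^bsub>R\<^esub> g \<in> arrow_ideal_power Q i"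
    using f g R_add_closed[of f g] by (simp add: arrow_ideal_power_iff) (simp add: path_algebra_simps)
qed

lemma submodule_J: "submodule (J i) scalars A"
  unfolding J_def bqa_class_def by (rule QV.submodule_quotient[OF submodule_arrow_ideal_power])

lemmas J_submodule = submoduleD[OF submodule_J A.is_abelian_group]

lemma J_closed: "x \<in> J i \<Longrightarrow> x \<in> carrier A"
  using J_submodule(1) by auto

lemma J_smult: "x \<in> J i \<Longrightarrow> c \<odot>\<^bsub>A\<^esub> x \<in> J i"
  using J_submodule(4) by simp

lemma J_diff: "\<lbrakk>x \<in> J i; y \<in> J i\<rbrakk> \<Longrightarrow> x \<ominus>\<^bsub>A\<^esub> y \<in> J i"
  using A.V.submoduleE(3,5)[OF submodule_J] by (simp add: a_minus_def)

lemma J_mono: "i \<le> j \<Longrightarrow> J j \<subseteq> J i"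
  unfolding J_def by (force simp: arrow_ideal_power_iff)

lemma J_0: "J 0 = carrier A"
  unfolding J_def carrier_A carrier_eq_arrow_ideal_power_0 ..

lemma J_mult: "\<lbrakk>x \<in> J i; y \<in> J j\<rbrakk> \<Longrightarrow> x \<otimes>\<^bsub>A\<^esub> y \<in> J (i + j)"
proof -
  assume "x \<in> J i" "y \<in> J j"
  then obtain f g where fg: "f \<in> arrow_ideal_power Q i" "x = cls f"
      "g \<in> arrow_ideal_power Q j" "y = cls g"
    by (auto simp: J_def)
  then have c: "f \<in> carrier R" "g \<in> carrier R" by (auto simp: arrow_ideal_power_iff)
  then show ?thesis
    unfolding J_def using fg arrow_ideal_power_mult[OF fg(1,3)] by (auto simp: cls_mult[symmetric])
qed

lemma obtain_J_zero:
  obtains m where "J m \<subseteq> {\<zero>\<^bsub>A\<^esub>}"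
proof -
  obtain m where "arrow_ideal_power Q m \<subseteq> I" using obtain_nilpotency by blast
  then have "J m \<subseteq> {\<zero>\<^bsub>A\<^esub>}"
    unfolding J_def using cls_eq_zero_iff I.a_Hcarr by blast
  then show thesis by (rule that)
qed

lemma path_in_J: "p \<in> paths Q \<Longrightarrow> cls (path_elem p) \<in> J (path_length p)"
  unfolding J_def using path_elem_carrier[of p Q]
  by (intro imageI) (auto simp: arrow_ideal_power_iff path_elem_def)

lemma path_Cons:
  assumes "(u, e # es, v) \<in> paths Q"
  shows "cls (path_elem (u, e # es, v)) = ar e \<otimes>\<^bsub>A\<^esub> cls (path_elem (head Q e, es, v))"
proof -
  have *: "e \<in> arcs Q" "u = tail Q e" "(head Q e, es, v) \<in> paths Q"
    using assms by (simp_all add: paths_Cons_iff)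
  have "path_elem (u, e # es, v) = path_elem (arrow_path Q e) \<otimes>\<^bsub>R\<^esub> path_elem (head Q e, es, v)"
    using * path_elem_mult[where 'k = 'k, of "tail Q e" "[e]" "head Q e" es v] arrow_path_in_paths[of e]
    by (simp add: arrow_path_def)
  then show ?thesis
    using * by (simp add: cls_mult path_elem_carrier arrow_path_in_paths)
qed

text \<open>The depth condition is imposed on arrows only, which generate \<open>A\<close> together
  with the vertices; \<open>Fil_J\<close> extends it to every power of the radical.\<close>

definition Fil :: "nat \<Rightarrow> (('v, 'e, 'k) bqa_elem \<Rightarrow> ('v, 'e, 'k) bqa_elem) set" where
  "Fil k = {d \<in> derivations A. (\<forall>v\<in>verts Q. d (vx v) = \<zero>\<^bsub>A\<^esub>) \<and> (\<forall>a\<in>arcs Q. d (ar a) \<in> J (Suc k))}"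

text \<open>The Leibniz rule replaces one arrow at a time by an element of \<open>J (Suc k)\<close>,
  which adds \<open>k\<close> to the length. A trivial path is sent to 0.\<close>

lemma Fil_path:
  assumes d: "d \<in> Fil k"
  shows "(u, es, v) \<in> paths Q \<Longrightarrow> d (cls (path_elem (u, es, v))) \<in> J (length es + k)"
proof (induction es arbitrary: u)
  case Nil
  then have "d (cls (path_elem (u, [], v))) = \<zero>\<^bsub>A\<^esub>"
    using d by (auto simp: Fil_def vertex_path_def paths_Nil_iff)
  then show ?case using J_submodule(2) by simp
next
  case (Cons e es)
  then have *: "e \<in> arcs Q" "(head Q e, es, v) \<in> paths Q" by (simp_all add: paths_Cons_iff)
  let ?p = "cls (path_elem (head Q e, es, v))"
  have "d (cls (path_elem (u, e # es, v))) = d (ar e) \<otimes>\<^bsub>A\<^esub> ?p \<oplus>\<^bsub>A\<^esub> ar e \<otimes>\<^bsub>A\<^esub> d ?p"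
    unfolding path_Cons[OF Cons.prems]
    using d * by (intro A.derivation_mult) (auto simp: Fil_def ar_closed cls_closed path_elem_carrier)
  moreover have "d (ar e) \<otimes>\<^bsub>A\<^esub> ?p \<in> J (Suc k + length es)"
    using d * path_in_J[OF *(2)] by (intro J_mult) (auto simp: Fil_def path_length_def)
  moreover have "ar e \<otimes>\<^bsub>A\<^esub> d ?p \<in> J (1 + (length es + k))"
    using path_in_J[OF arrow_path_in_paths[OF *(1)]] Cons.IH[OF *(2)] by (intro J_mult) auto
  ultimately show ?case
    using J_submodule(3) by (simp add: add.commute)
qed

text \<open>Linearity carries \<open>Fil_path\<close> over to combinations of paths. The case
  \<open>i = 0\<close> puts all values of \<open>d\<close> into \<open>J k\<close>, which is why
  \<open>Fil m\<close> vanishes once \<open>J m\<close> does.\<close>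

lemma Fil_J:
  assumes d: "d \<in> Fil k" and x: "x \<in> J i"
  shows "d x \<in> J (i + k)"
proof -
  have D: "d \<in> derivations A" using d by (simp add: Fil_def)
  obtain f where "f \<in> arrow_ideal_power Q i" "x = cls f" using x by (auto simp: J_def)
  then show ?thesis
  proof (induction f arbitrary: x rule: arrow_ideal_power_induct)
    case zero
    then show ?case
      using J_submodule(2) by (simp add: cls_zero A.derivation_zero[OF D])
  next
    case (add f g)
    then show ?case
      using J_submodule(3)
      by (simp add: arrow_ideal_power_iff cls_add A.derivation_add[OF D] cls_closed)
  next
    case (path c p)
    then have "d (cls (path_elem p)) \<in> J (path_length p + k)"
      using Fil_path[OF d] by (cases p) (auto simp: path_length_def)
    then have "d (cls (path_elem p)) \<in> J (i + k)"
      using J_mono[of "i + k" "path_length p + k"] path by auto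
    then show ?case
      using path
      by (simp add: cls_smult path_elem_carrier A.derivation_smult[OF D] cls_closed J_smult)
  qed
qed

lemma submodule_Fil: "submodule (Fil k) scalars (der_lie A)"
proof (rule submodule_scalarsI[OF A.module_der_lie])
  show "Fil k \<subseteq> carrier (der_lie A)" by (auto simp: Fil_def)
  show "\<zero>\<^bsub>der_lie A\<^esub> \<in> Fil k"
    using A.zero_derivation J_submodule(2) by (auto simp: Fil_def vx_closed ar_closed)
  fix x assume x: "x \<in> Fil k"
  show "c \<odot>\<^bsub>der_lie A\<^esub> x \<in> Fil k" for c
    using x A.smult_derivation[of x c] J_smult
    by (auto simp: Fil_def vx_closed ar_closed A.smult_zero)
  fix y assume y: "y \<in> Fil k"
  show "x \<oplus>\<^bsub>der_lie A\<^esub> y \<in> Fil k"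
    using x y A.add_derivation[of x y] J_submodule(3)
    by (auto simp: Fil_def vx_closed ar_closed)
qed

text \<open>A bracket of derivations that kill the vertices kills them as well, so only arrows need
  checking. The depth \<open>n\<close> is free because degree 0 requires a sharper estimate than the
  general one.\<close>

lemma bracket_Fil_aux:
  assumes x: "x \<in> Fil k" and y: "y \<in> Fil l"
    and "\<And>a. a \<in> arcs Q \<Longrightarrow> x (y (ar a)) \<ominus>\<^bsub>A\<^esub> y (x (ar a)) \<in> J (Suc n)"
  shows "bracket (der_lie A) x y \<in> Fil n"
  using assms A.bracket_derivation[of x y] A.derivation_zero[of x] A.derivation_zero[of y]
  by (auto simp: Fil_def vx_closed ar_closed a_minus_def)

text \<open>An arrow lies in \<open>J 1\<close> and each derivation adds its own depth, so both
  composites land in \<open>J (1 + k + l)\<close>.\<close>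

lemma bracket_Fil:
  assumes x: "x \<in> Fil k" and y: "y \<in> Fil l"
  shows "bracket (der_lie A) x y \<in> Fil (k + l)"
proof (rule bracket_Fil_aux[OF x y])
  fix a assume a: "a \<in> arcs Q"
  have "x (y (ar a)) \<in> J (Suc l + k)" "y (x (ar a)) \<in> J (Suc k + l)"
    using x y a Fil_J[OF x, of "y (ar a)" "Suc l"] Fil_J[OF y, of "x (ar a)" "Suc k"]
    by (simp_all add: Fil_def)
  then show "x (y (ar a)) \<ominus>\<^bsub>A\<^esub> y (x (ar a)) \<in> J (Suc (k + l))"
    using J_diff by (simp add: add.commute)
qed

lemma Fil_mono: "k \<le> l \<Longrightarrow> Fil l \<subseteq> Fil k"
  using J_mono[of "Suc k" "Suc l"] by (auto simp: Fil_def)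

lemma obtain_Fil_zero:
  obtains m where "Fil m \<subseteq> {\<zero>\<^bsub>der_lie A\<^esub>}"
proof -
  obtain m where m: "J m \<subseteq> {\<zero>\<^bsub>A\<^esub>}" by (rule obtain_J_zero)
  have "d = \<zero>\<^bsub>der_lie A\<^esub>" if d: "d \<in> Fil m" for d
  proof -
    have D: "d \<in> derivations A" using d by (simp add: Fil_def)
    have "d x = \<zero>\<^bsub>A\<^esub>" if "x \<in> carrier A" for x
      using Fil_J[OF d, of x 0] that m by (auto simp: J_0)
    then show ?thesis
      using D A.zero_derivation by (intro A.derivation_eqI) auto
  qed
  then show thesis using that by blast
qed

end

section \<open>Normal forms\<close>

lemma linear_order_on_finite_max:
  assumes r: "linear_order_on S r" and B: "finite B" "B \<noteq> {}" "B \<subseteq> S"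
  shows "\<exists>p\<in>B. \<forall>q\<in>B. (q, p) \<in> r"
  using B
proof (induction B rule: finite_ne_induct)
  case (singleton x)
  then show ?case
    using r by (auto simp: order_on_defs refl_on_def)
next
  case (insert x B)
  then obtain p where p: "p \<in> B" "\<forall>q\<in>B. (q, p) \<in> r" by auto
  have S: "x \<in> S" "p \<in> S" using p insert.prems by auto
  have refl: "(x, x) \<in> r" "(p, p) \<in> r" and tr: "trans r"
    using r S by (auto simp: order_on_defs refl_on_def)
  have tot: "(x, p) \<in> r \<or> (p, x) \<in> r"
    using r S refl by (cases "x = p") (auto simp: order_on_defs total_on_def)
  from tot show ?case
  proof
    assume "(x, p) \<in> r"
    then show ?case using p by auto
  next
    assume "(p, x) \<in> r"
    then show ?case using p refl tr by (auto dest: transD)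
  qed
qed

context bound_quiver
begin

text \<open>A linear order has a maximum on the finite nonempty support, and antisymmetry makes it
  unique, so the description by \<open>THE\<close> denotes it.\<close>

lemma leading_path_properties:
  assumes r: "linear_order_on (paths Q) r" and f: "f \<in> carrier R" "f \<noteq> (\<lambda>_. 0)"
  shows "f (leading_path r f) \<noteq> 0" "\<And>q. f q \<noteq> 0 \<Longrightarrow> (q, leading_path r f) \<in> r"
proof -
  have "finite {p. f p \<noteq> 0}" "{p. f p \<noteq> 0} \<noteq> {}" "{p. f p \<noteq> 0} \<subseteq> paths Q"
    using f by (auto simp: path_algebra_simps)
  from linear_order_on_finite_max[OF r this]
  obtain p where p: "f p \<noteq> 0" "\<forall>q. f q \<noteq> 0 \<longrightarrow> (q, p) \<in> r"
    by blast
  have anti: "antisym r" using r by (simp add: order_on_defs)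
  have "leading_path r f = p"
    unfolding leading_path_def 
  proof (rule the_equality)
    show "f p \<noteq> 0 \<and> (\<forall>q. f q \<noteq> 0 \<longrightarrow> (q, p) \<in> r)" using p by blast
    fix q assume "f q \<noteq> 0 \<and> (\<forall>p. f p \<noteq> 0 \<longrightarrow> (p, q) \<in> r)"
    then have "(p, q) \<in> r" "(q, p) \<in> r" using p by blast+
    then show "q = p" using antisymD[OF anti] by blast
  qed
  then show "f (leading_path r f) \<noteq> 0" "\<And>q. f q \<noteq> 0 \<Longrightarrow> (q, leading_path r f) \<in> r"
    using p by auto
qed

lemma finite_short_paths: "finite {p \<in> paths Q. path_length p < m}"
proof -
  have "{p \<in> paths Q. path_length p < m}
      \<subseteq> verts Q \<times> {es. set es \<subseteq> arcs Q \<and> length es \<le> m} \<times> verts Q"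
  proof
    fix p assume p: "p \<in> {p \<in> paths Q. path_length p < m}"
    obtain u es v where uv: "p = (u, es, v)" by (cases p)
    then have "awalk u es v" "length es < m" using p by (auto simp: paths_def path_length_def)
    then show "p \<in> verts Q \<times> {es. set es \<subseteq> arcs Q \<and> length es \<le> m} \<times> verts Q"
      unfolding uv using awlast_in_verts by (auto simp: awalk_def dest: awlast_if_cas)
  qed
  then show ?thesis
    
    by (rule finite_subset) (intro finite_cartesian_product finite_verts finite_lists_length_le finite_arcs)
qed

text \<open>Cutting off all paths of length at least \<open>m\<close> does not change the class,
  since they lie in \<open>I\<close>. Among the finitely many paths left, repeatedly cancelling the
  largest reducible path must stop, for any linear order.\<close>

lemma normal_form:
  assumes r: "linear_order_on (paths Q) r" and f: "f \<in> carrier R"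
  shows "\<exists>g\<in>carrier R. cls g = cls f \<and> {p. g p \<noteq> 0} \<subseteq> basis_paths Q I r"
proof -
  obtain m where m: "arrow_ideal_power Q m \<subseteq> I" by (rule obtain_nilpotency)
  let ?P = "{p \<in> paths Q. path_length p < m}"
  have P: "finite ?P" by (rule finite_short_paths)
  define tr where "tr f = (\<lambda>p. if path_length p < m then f p else 0)"
    for f :: "('v, 'e) qpath \<Rightarrow> 'k"
  have tr_carrier: "tr f \<in> carrier R" if "f \<in> carrier R" for f
    using that by (auto simp: path_algebra_simps tr_def intro: rev_finite_subset[of "{p. f p \<noteq> 0}"])
  have tr_supp: "{p. tr f p \<noteq> 0} \<subseteq> ?P" if "f \<in> carrier R" for f
    using that by (auto simp: path_algebra_simps tr_def)
  have cls_tr: "cls (tr f) = cls f" if f: "f \<in> carrier R" for f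
  proof -
    define g where "g = (\<lambda>p. if path_length p < m then 0 else f p)"
    have g: "g \<in> arrow_ideal_power Q m"
      using f by (auto simp: arrow_ideal_power_iff path_algebra_simps g_def
          intro: rev_finite_subset[of "{p. f p \<noteq> 0}"])
    then have g': "g \<in> carrier R" "cls g = \<zero>\<^bsub>A\<^esub>"
      using m cls_eq_zero_iff by (auto simp: arrow_ideal_power_iff)
    have "f = tr f \<oplus>\<^bsub>R\<^esub> g"
      by (auto simp: path_algebra_simps tr_def g_def)
    then have "cls f = cls (tr f) \<oplus>\<^bsub>A\<^esub> cls g" using tr_carrier[OF f] g' by (metis cls_add)
    then show ?thesis using g' cls_closed[OF tr_carrier[OF f]] by simp
  qed
  \<comment> \<open>Cancelling the largest reducible path of \<open>f\<close> shrinks this finite set.\<close>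
  define down where "down f = {q \<in> ?P. \<exists>p. f p \<noteq> 0 \<and> p \<notin> basis_paths Q I r \<and> (q, p) \<in> r}"
    for f :: "('v, 'e) qpath \<Rightarrow> 'k"
  have trans: "trans r" and anti: "antisym r" and refl: "\<And>p. p \<in> paths Q \<Longrightarrow> (p, p) \<in> r"
    using r by (auto simp: order_on_defs refl_on_def)
  have "\<exists>g\<in>carrier R. cls g = cls f \<and> {p. g p \<noteq> 0} \<subseteq> basis_paths Q I r"
    if "f \<in> carrier R" "{p. f p \<noteq> 0} \<subseteq> ?P" for f
    using that
  proof (induction "card (down f)" arbitrary: f rule: less_induct)
    case less
    let ?N = "{p. f p \<noteq> 0 \<and> p \<notin> basis_paths Q I r}"
    show ?case
    proof (cases "?N = {}")
      case True
      then show ?thesis using less.prems by blast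
    next
      case False
      have "finite ?N" "?N \<subseteq> paths Q"
        using less.prems P by (auto intro: rev_finite_subset[OF P])
      then obtain p where p: "f p \<noteq> 0" "p \<notin> basis_paths Q I r"
        and p_max: "\<And>q. \<lbrakk>f q \<noteq> 0; q \<notin> basis_paths Q I r\<rbrakk> \<Longrightarrow> (q, p) \<in> r"
        using linear_order_on_finite_max[OF r _ False] by auto
      have pP: "p \<in> paths Q" "path_length p < m" using p less.prems by auto
      then obtain h where h: "h \<in> I" "h \<noteq> (\<lambda>_. 0)" "leading_path r h = p"
        using p by (auto simp: basis_paths_def)
      have hR: "h \<in> carrier R" using h by (auto intro: I.a_Hcarr)
      have h_lead: "h p \<noteq> 0" "\<And>q. h q \<noteq> 0 \<Longrightarrow> (q, p) \<in> r"
        using leading_path_properties[OF r hR h(2)] h(3) by auto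
      \<comment> \<open>Chosen to cancel \<open>p\<close> in \<open>f\<close>; as \<open>p\<close>
        is short, \<open>tr h\<close> and \<open>h\<close> have the same coefficient there.\<close>
      define c where "c = - (f p / h p)"
      \<comment> \<open>\<open>h\<close> is truncated too, as its long paths would lead out of
        \<open>?P\<close>; its class remains zero.\<close>
      define f' where "f' = f \<oplus>\<^bsub>R\<^esub> c \<odot>\<^bsub>R\<^esub> tr h"
      have f'_eq: "f' q = f q + c * tr h q" for q by (simp add: f'_def path_algebra_simps)
      have "c \<odot>\<^bsub>R\<^esub> tr h \<in> carrier R" using tr_carrier[OF hR] by simp
      then have f': "f' \<in> carrier R" unfolding f'_def using less.prems by (intro R_add_closed)
      have "cls (tr h) = \<zero>\<^bsub>A\<^esub>" using cls_tr[OF hR] cls_eq_zero_iff[OF hR] h(1) by simp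
      then have cls_f': "cls f' = cls f"
        unfolding f'_def using less.prems tr_carrier[OF hR]
        by (simp add: cls_add cls_smult A.smult_zero cls_closed)
      have supp: "{q. f' q \<noteq> 0} \<subseteq> ?P"
      proof
        fix q assume "q \<in> {q. f' q \<noteq> 0}"
        then have "f q \<noteq> 0 \<or> tr h q \<noteq> 0" by (auto simp: f'_eq)
        then show "q \<in> ?P" using less.prems(2) tr_supp[OF hR] by blast
      qed
      have f'p: "f' p = 0" using h_lead(1) pP by (simp add: f'_eq c_def tr_def)
      \<comment> \<open>A reducible path of \<open>f'\<close> comes either from \<open>f\<close>,
        where \<open>p\<close> is the largest one, or from \<open>h\<close>, whose leading path is
        \<open>p\<close>.\<close>
      have below: "(q, p) \<in> r" if "f' q \<noteq> 0" "q \<notin> basis_paths Q I r" for q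
        using that p_max[of q] h_lead(2)[of q] by (cases "f q = 0") (auto simp: f'_eq tr_def split: if_splits)
      have "p \<in> down f" using p pP refl unfolding down_def by blast
      \<comment> \<open>A reducible path of \<open>f'\<close> above \<open>p\<close> would equal
        \<open>p\<close> by \<open>below\<close>, but \<open>f'\<close> vanishes at
        \<open>p\<close>.\<close>
      moreover have "p \<notin> down f'"
        using below f'p antisymD[OF anti] unfolding down_def by blast
      moreover have "down f' \<subseteq> down f"
        using below p transD[OF trans] unfolding down_def by blast
      moreover have "finite (down f)" unfolding down_def by (rule rev_finite_subset[OF P]) blast
      ultimately have "card (down f') < card (down f)"
        by (intro psubset_card_mono) auto
      from less.hyps[OF this f' supp] show ?thesis using cls_f' by simp
    qed
  qed
  from this[OF tr_carrier[OF f] tr_supp[OF f]] show ?thesis using cls_tr[OF f] by simp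
qed

section \<open>Derivations vanishing on the vertices\<close>

text \<open>For vertices \<open>u\<close> and \<open>v\<close> this is e_u f e_v in coordinates. As
  a mere restriction of the support, it sends combinations of basis paths to such
  combinations.\<close>

definition corner :: "'v \<Rightarrow> 'v \<Rightarrow> (('v, 'e) qpath \<Rightarrow> 'k) \<Rightarrow> ('v, 'e) qpath \<Rightarrow> 'k" where
  "corner u v f = (\<lambda>p. if fst p = u \<and> snd (snd p) = v then f p else 0)"

lemma corner_closed: "f \<in> carrier R \<Longrightarrow> corner u v f \<in> carrier R"
  by (auto simp: path_algebra_simps corner_def intro: rev_finite_subset[of "{p. f p \<noteq> 0}"])

text \<open>A representative of a class in e_u A e_v may involve paths between other vertices;
  multiplying by the two trivial paths deletes them and fixes the class.\<close>

lemma corner_cls: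
  assumes "u \<in> verts Q" "v \<in> verts Q" "f \<in> carrier R"
    and "vx u \<otimes>\<^bsub>A\<^esub> cls f \<otimes>\<^bsub>A\<^esub> vx v = cls f"
  shows "cls (corner u v f) = cls f"
proof -
  have uv: "path_elem (vertex_path u) \<in> carrier R" "path_elem (vertex_path v) \<in> carrier R"
    using assms(1,2) by (auto intro: path_elem_carrier vertex_path_in_paths)
  have uf: "path_elem (vertex_path u) \<otimes>\<^bsub>R\<^esub> f \<in> carrier R" using uv assms(3) by simp
  have "path_elem (vertex_path u) \<otimes>\<^bsub>R\<^esub> f \<otimes>\<^bsub>R\<^esub> path_elem (vertex_path v) = corner u v f"
    using mult_vertex[OF assms(2) uf] vertex_mult[OF assms(1,3)] by (auto simp: corner_def)
  then show ?thesis using assms(3,4) uv uf by (simp add: cls_hom)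
qed

lemma ar_corner:
  assumes a: "a \<in> arcs Q"
  shows "vx (tail Q a) \<otimes>\<^bsub>A\<^esub> ar a = ar a" "ar a \<otimes>\<^bsub>A\<^esub> vx (head Q a) = ar a"
proof -
  have c: "path_elem (arrow_path Q a) \<in> carrier R" "path_elem (vertex_path (tail Q a)) \<in> carrier R"
     "path_elem (vertex_path (head Q a)) \<in> carrier R"
    using a by (intro path_elem_carrier arrow_path_in_paths vertex_path_in_paths; simp)+
  have "path_elem (vertex_path (tail Q a)) \<otimes>\<^bsub>R\<^esub> path_elem (arrow_path Q a) = path_elem (arrow_path Q a)"
    using a unfolding vertex_mult[OF tail_in_verts[OF a] c(1)]
    by (auto simp: path_elem_def arrow_path_def)
  then show "vx (tail Q a) \<otimes>\<^bsub>A\<^esub> ar a = ar a" using c by (simp add: cls_hom)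
  have "path_elem (arrow_path Q a) \<otimes>\<^bsub>R\<^esub> path_elem (vertex_path (head Q a)) = path_elem (arrow_path Q a)"
    using a unfolding mult_vertex[OF head_in_verts[OF a] c(1)]
    by (auto simp: path_elem_def arrow_path_def)
  then show "ar a \<otimes>\<^bsub>A\<^esub> vx (head Q a) = ar a" using c by (simp add: cls_hom)
qed

text \<open>Apply the Leibniz rule to e_u a = a and a e_v = a, where d(e_u) = d(e_v) = 0.\<close>

lemma derivation_ar_corner:
  assumes d: "d \<in> derivations A" and d0: "\<forall>v\<in>verts Q. d (vx v) = \<zero>\<^bsub>A\<^esub>" and a: "a \<in> arcs Q"
  shows "vx (tail Q a) \<otimes>\<^bsub>A\<^esub> d (ar a) \<otimes>\<^bsub>A\<^esub> vx (head Q a) = d (ar a)"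
proof -
  have c: "ar a \<in> carrier A" "vx (tail Q a) \<in> carrier A" "vx (head Q a) \<in> carrier A"
    "d (ar a) \<in> carrier A"
    using a by (auto intro: ar_closed vx_closed A.derivation_closed[OF d])
  have "d (ar a) = vx (tail Q a) \<otimes>\<^bsub>A\<^esub> d (ar a)"
    using A.derivation_mult[OF d c(2,1)] c a d0 by (simp add: ar_corner)
  moreover have "d (ar a) = d (ar a) \<otimes>\<^bsub>A\<^esub> vx (head Q a)"
    using A.derivation_mult[OF d c(1,3)] c a d0 by (simp add: ar_corner)
  ultimately show ?thesis by metis
qed

text \<open>A path parallel to an arrow can have length 0 only if the arrow is a loop, and a nonzero
  coefficient of that trivial path in the normal form of d(a) is exactly what an empty
  \<open>Sigma0\<close> rules out.\<close>

lemma derivation_in_Fil_0: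
  assumes r: "linear_order_on (paths Q) r" and Sigma0: "Sigma0 Q I r = {}"
    and d: "d \<in> derivations A" and d0: "\<forall>v\<in>verts Q. d (vx v) = \<zero>\<^bsub>A\<^esub>"
  shows "d \<in> Fil 0"
proof -
  have "\<forall>a\<in>arcs Q. \<exists>g. g \<in> carrier R \<and> cls g = d (ar a) \<and>
      {p. g p \<noteq> 0} \<subseteq> {p \<in> basis_paths Q I r. fst p = tail Q a \<and> snd (snd p) = head Q a}"
  proof
    fix a assume a: "a \<in> arcs Q"
    have "d (ar a) \<in> carrier A" using a by (intro A.derivation_closed[OF d] ar_closed)
    then obtain f where "f \<in> carrier R" "d (ar a) = cls f" by (auto simp: carrier_A)
    then obtain g where g: "g \<in> carrier R" "cls g = d (ar a)" "{p. g p \<noteq> 0} \<subseteq> basis_paths Q I r"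
      using normal_form[OF r] by metis
    \<comment> \<open>Cutting down to the corner after the reduction makes the paths parallel to
      \<open>a\<close> while the support still consists of basis paths.\<close>
    have "cls (corner (tail Q a) (head Q a) g) = cls g"
      using a g derivation_ar_corner[OF d d0 a] by (intro corner_cls) auto
    then show "\<exists>g. g \<in> carrier R \<and> cls g = d (ar a) \<and>
      {p. g p \<noteq> 0} \<subseteq> {p \<in> basis_paths Q I r. fst p = tail Q a \<and> snd (snd p) = head Q a}"
      using g corner_closed[OF g(1), of "tail Q a" "head Q a"]
      by (intro exI[of _ "corner (tail Q a) (head Q a) g"]) (auto simp: corner_def split: if_splits)
  qed
  from bchoice[OF this] obtain g where g: "\<And>a. a \<in> arcs Q \<Longrightarrow> g a \<in> carrier R"
      "\<And>a. a \<in> arcs Q \<Longrightarrow> cls (g a) = d (ar a)"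
      "\<And>a. a \<in> arcs Q \<Longrightarrow>
        {p. g a p \<noteq> 0} \<subseteq> {p \<in> basis_paths Q I r. fst p = tail Q a \<and> snd (snd p) = head Q a}"
    by auto
  \<comment> \<open>The normal forms of all values d(a) bundled into one coefficient function;
    \<open>d\<close> itself witnesses membership in \<open>ker_delta1\<close>.\<close>
  define x where "x = (\<lambda>(a, b). if a \<in> arcs Q then g a b else 0)"
  have supp: "{ab. x ab \<noteq> 0} = (SIGMA a:arcs Q. {p. g a p \<noteq> 0})"
    by (auto simp: x_def split: if_splits)
  have "x \<in> ker_delta1 Q I r"
    unfolding ker_delta1_def
  proof (intro CollectI conjI bexI[OF _ d] d0 ballI)
    show "finite {ab. x ab \<noteq> 0}"
      unfolding supp using g(1) by (intro finite_SigmaI) (auto simp: path_algebra_simps)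
    show "{ab. x ab \<noteq> 0} \<subseteq> parallel_pairs Q I r"
      unfolding supp parallel_pairs_def using g(3) by fastforce
    show "d (ar a) = cls (\<lambda>b. x (a, b))" if "a \<in> arcs Q" for a
      using that g(2) by (simp add: x_def)
  qed
  then have loop: "g a (vertex_path (tail Q a)) = 0" if "a \<in> arcs Q" "head Q a = tail Q a" for a
    using Sigma0 that by (fastforce simp: Sigma0_def x_def)
  have "g a \<in> arrow_ideal_power Q 1" if a: "a \<in> arcs Q" for a
    unfolding arrow_ideal_power_iff
  proof (intro conjI allI impI g(1)[OF a])
    fix p assume p: "g a p \<noteq> 0"
    obtain es where es: "p = (tail Q a, es, head Q a)"
      using p g(3)[OF a] by (cases p) auto
    have "p \<in> paths Q" using p path_algebra_outside[OF g(1)[OF a]] by blast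
    \<comment> \<open>An empty list forces tail and head to agree, and at a loop the coefficient of
      the trivial path is zero by \<open>loop\<close>.\<close>
    then have "es \<noteq> []"
      using p es loop[OF a] by (auto simp: paths_Nil_iff vertex_path_def)
    then show "1 \<le> path_length p" using es by (cases es) (auto simp: path_length_def)
  qed
  then have "d (ar a) \<in> J 1" if "a \<in> arcs Q" for a
    using that g(2)[OF that] unfolding J_def by force
  then show ?thesis using d d0 by (simp add: Fil_def)
qed

text \<open>Modulo \<open>J 2\<close> the value d(a) is a combination of arrows parallel to
  \<open>a\<close>, and \<open>par\<close> leaves only \<open>a\<close> itself.\<close>

lemma Fil_0_diagonal:
  assumes par: "\<And>a b. \<lbrakk>a \<in> arcs Q; b \<in> arcs Q; tail Q a = tail Q b; head Q a = head Q b\<rbrakk> \<Longrightarrow> a = b"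
    and d: "d \<in> Fil 0" and a: "a \<in> arcs Q"
  obtains c z where "z \<in> J 2" "d (ar a) = c \<odot>\<^bsub>A\<^esub> ar a \<oplus>\<^bsub>A\<^esub> z"
proof -
  have D: "d \<in> derivations A" "\<forall>v\<in>verts Q. d (vx v) = \<zero>\<^bsub>A\<^esub>" "d (ar a) \<in> J 1"
    using d a by (auto simp: Fil_def)
  obtain f where f: "f \<in> arrow_ideal_power Q 1" "d (ar a) = cls f" using D(3) by (auto simp: J_def)
  have fR: "f \<in> carrier R" using f by (simp add: arrow_ideal_power_iff)
  define g where "g = corner (tail Q a) (head Q a) f"
  have gR: "g \<in> carrier R" unfolding g_def using fR by (rule corner_closed)
  have g: "d (ar a) = cls g"
    unfolding g_def f(2) using a fR derivation_ar_corner[OF D(1,2) a] f(2)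
    by (intro corner_cls[symmetric]) auto
  \<comment> \<open>Without the arrow \<open>a\<close> only paths of length at least 2 remain:
    length 0 is excluded by the choice of \<open>f\<close>, length 1 by \<open>par\<close>.\<close>
  define h where "h = g(arrow_path Q a := 0)"
  define c where "c = g (arrow_path Q a)"
  have hR: "h \<in> carrier R"
    using gR by (auto simp: h_def path_algebra_simps intro: rev_finite_subset[of "{p. g p \<noteq> 0}"])
  have "2 \<le> path_length p" if p: "h p \<noteq> 0" for p
  proof -
    have gp: "g p \<noteq> 0" "p \<noteq> arrow_path Q a" using p by (auto simp: h_def split: if_splits)
    then obtain es where es: "p = (tail Q a, es, head Q a)"
      by (cases p) (auto simp: g_def corner_def split: if_splits)
    have "f p \<noteq> 0" using gp by (auto simp: g_def corner_def split: if_splits)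
    then have "1 \<le> path_length p" using f(1) unfolding arrow_ideal_power_iff by blast
    moreover have "path_length p \<noteq> 1"
    proof
      assume "path_length p = 1"
      then obtain b where b: "es = [b]" using es by (auto simp: path_length_def length_Suc_conv)
      have "p \<in> paths Q" using gp path_algebra_outside[OF gR] by blast
      then have "b \<in> arcs Q" "tail Q b = tail Q a" "head Q b = head Q a"
        unfolding es b by (auto simp: paths_Cons_iff paths_Nil_iff)
      then have "b = a" using par a by blast
      then show False using gp(2) es b by (simp add: arrow_path_def)
    qed
    ultimately show ?thesis by simp
  qed
  then have "h \<in> arrow_ideal_power Q 2" using hR by (simp add: arrow_ideal_power_iff)
  then have "cls h \<in> J 2" unfolding J_def by blast
  moreover have "g = c \<odot>\<^bsub>R\<^esub> path_elem (arrow_path Q a) \<oplus>\<^bsub>R\<^esub> h"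
    by (auto simp: path_algebra_simps c_def h_def path_elem_def)
  moreover have "path_elem (arrow_path Q a) \<in> carrier R"
    using a by (intro path_elem_carrier arrow_path_in_paths)
  ultimately show thesis
    using that[of "cls h" c] g hR by (simp add: cls_add cls_smult)
qed

text \<open>Both composites have the same leading part (b c) a because scalars commute; all other
  terms lie in \<open>J 2\<close>, which derivations in \<open>Fil 0\<close> preserve.\<close>

lemma bracket_Fil_0:
  assumes par: "\<And>a b. \<lbrakk>a \<in> arcs Q; b \<in> arcs Q; tail Q a = tail Q b; head Q a = head Q b\<rbrakk> \<Longrightarrow> a = b"
    and x: "x \<in> Fil 0" and y: "y \<in> Fil 0"
  shows "bracket (der_lie A) x y \<in> Fil 1"
proof (rule bracket_Fil_aux[OF x y])
  fix a assume a: "a \<in> arcs Q"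
  have X: "x \<in> derivations A" and Y: "y \<in> derivations A" using x y by (auto simp: Fil_def)
  obtain b z where z: "z \<in> J 2" "x (ar a) = b \<odot>\<^bsub>A\<^esub> ar a \<oplus>\<^bsub>A\<^esub> z"
    using Fil_0_diagonal[OF par x a] by blast
  obtain c w where w: "w \<in> J 2" "y (ar a) = c \<odot>\<^bsub>A\<^esub> ar a \<oplus>\<^bsub>A\<^esub> w"
    using Fil_0_diagonal[OF par y a] by blast
  note closed = ar_closed[OF a] J_closed[OF z(1)] J_closed[OF w(1)]
  have xw: "x w \<in> J 2" and yz: "y z \<in> J 2"
    using Fil_J[OF x w(1)] Fil_J[OF y z(1)] by simp_all
  have diff: "(t \<oplus>\<^bsub>A\<^esub> p \<oplus>\<^bsub>A\<^esub> q) \<ominus>\<^bsub>A\<^esub> (t \<oplus>\<^bsub>A\<^esub> s \<oplus>\<^bsub>A\<^esub> u) = (p \<oplus>\<^bsub>A\<^esub> q) \<ominus>\<^bsub>A\<^esub> (s \<oplus>\<^bsub>A\<^esub> u)"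
    if "t \<in> carrier A" "p \<in> carrier A" "q \<in> carrier A" "s \<in> carrier A" "u \<in> carrier A" for t p q s u
    using that by algebra
  have "x (y (ar a)) = (b * c) \<odot>\<^bsub>A\<^esub> ar a \<oplus>\<^bsub>A\<^esub> c \<odot>\<^bsub>A\<^esub> z \<oplus>\<^bsub>A\<^esub> x w"
    unfolding w(2) using closed
    by (simp add: A.derivation_add[OF X] A.derivation_smult[OF X] z(2) A.smult_distrib_left
        A.smult_smult mult.commute)
  moreover have "y (x (ar a)) = (b * c) \<odot>\<^bsub>A\<^esub> ar a \<oplus>\<^bsub>A\<^esub> b \<odot>\<^bsub>A\<^esub> w \<oplus>\<^bsub>A\<^esub> y z"
    unfolding z(2) using closed
    by (simp add: A.derivation_add[OF Y] A.derivation_smult[OF Y] w(2) A.smult_distrib_left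
        A.smult_smult)
  ultimately have "x (y (ar a)) \<ominus>\<^bsub>A\<^esub> y (x (ar a))
      = (c \<odot>\<^bsub>A\<^esub> z \<oplus>\<^bsub>A\<^esub> x w) \<ominus>\<^bsub>A\<^esub> (b \<odot>\<^bsub>A\<^esub> w \<oplus>\<^bsub>A\<^esub> y z)"
    using closed J_closed[OF xw] J_closed[OF yz] by (simp add: diff)
  also have "\<dots> \<in> J 2"
    using z(1) w(1) xw yz by (intro J_diff J_submodule(3) J_smult)
  finally show "x (y (ar a)) \<ominus>\<^bsub>A\<^esub> y (x (ar a)) \<in> J (Suc 1)"
    by (simp add: numeral_2_eq_2)
qed

section \<open>Solvability of the quotient by inner derivations\<close>

lemma derivation_eq_ad_on_vertices:
  assumes d: "d \<in> derivations A"
  shows "\<exists>a\<in>carrier A. \<forall>v\<in>verts Q. d (vx v) = A.ad a (vx v)"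
  using d finite_verts vx_closed vx_mult sum_vx by (intro A.derivation_eq_ad_on_idempotents) auto

lemma solvable_HH1:
  assumes r: "linear_order_on (paths Q) r" and Sigma0: "Sigma0 Q I r = {}"
    and par: "\<And>a b. \<lbrakk>a \<in> arcs Q; b \<in> arcs Q; tail Q a = tail Q b; head Q a = head Q b\<rbrakk> \<Longrightarrow> a = b"
  shows "solvable_lie_algebra (HH1 A)"
proof -
  let ?D = "der_lie A" and ?N = "inner_derivations A"
  let ?q = "\<lambda>d. ?N +>\<^bsub>?D\<^esub> d"
  obtain m where m: "Fil m \<subseteq> {\<zero>\<^bsub>?D\<^esub>}" by (rule obtain_Fil_zero)
  show ?thesis
  proof (rule lie_algebra.solvableI[OF A.HH.lie_algebra_quotient])
    show "submodule (?q ` Fil n) scalars (HH1 A)" for n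
      by (rule A.HH.Q.submodule_quotient[OF submodule_Fil])
    show "?q ` Fil m \<subseteq> {\<zero>\<^bsub>HH1 A\<^esub>}"
      using m A.HH.Q.zero_quotient by auto
    show "carrier (HH1 A) \<subseteq> ?q ` Fil 0"
    proof
      fix C assume "C \<in> carrier (HH1 A)"
      then obtain d where d: "d \<in> derivations A" "C = ?q d"
        by (auto simp: A.HH.Q.carrier_quotient)
      obtain a where a: "a \<in> carrier A" "\<forall>v\<in>verts Q. d (vx v) = A.ad a (vx v)"
        using derivation_eq_ad_on_vertices[OF d(1)] by blast
      have ad: "A.ad a \<in> derivations A" using a(1) by (rule A.ad_derivation)
      \<comment> \<open>Subtracting the inner derivation that agrees with \<open>d\<close> on the
        vertices keeps the class and makes \<open>derivation_in_Fil_0\<close> applicable.\<close>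
      define d' where "d' = d \<oplus>\<^bsub>?D\<^esub> (- 1) \<odot>\<^bsub>?D\<^esub> A.ad a"
      have d': "d' \<in> derivations A"
        unfolding d'_def using A.add_derivation[OF d(1) A.smult_derivation[OF ad, of "- 1"]]
        by simp
      have neg: "y \<oplus>\<^bsub>A\<^esub> (- 1) \<odot>\<^bsub>A\<^esub> y = \<zero>\<^bsub>A\<^esub>" if "y \<in> carrier A" for y
        using that A.smult_distrib_right[of y 1 "- 1"] by (simp add: A.smult_1 A.smult_0)
      have "\<forall>v\<in>verts Q. d' (vx v) = \<zero>\<^bsub>A\<^esub>"
        using a A.derivation_closed[OF ad] by (simp add: d'_def vx_closed neg)
      then have "d' \<in> Fil 0" using derivation_in_Fil_0[OF r Sigma0 d'] by blast
      moreover have "?q d' = ?q d"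
      proof -
        have inner: "(- 1) \<odot>\<^bsub>?D\<^esub> A.ad a \<in> ?N"
          by (rule submoduleD(4)[OF A.HH.Q.sub A.HH.M.abelian_group_axioms])
            (auto simp: A.inner_derivations_eq a(1))
        note inner_carrier = A.HH.Q.W.a_Hcarr[OF inner]
        have "?q d' = ?q d \<oplus>\<^bsub>HH1 A\<^esub> ?q ((- 1) \<odot>\<^bsub>?D\<^esub> A.ad a)"
          unfolding d'_def using A.HH.Q.add_quotient[OF _ inner_carrier, of d] d(1) by simp
        also have "?q ((- 1) \<odot>\<^bsub>?D\<^esub> A.ad a) = \<zero>\<^bsub>HH1 A\<^esub>"
          using A.HH.Q.coset_eq_zero_iff[OF inner_carrier] inner by blast
        also have "?q d \<oplus>\<^bsub>HH1 A\<^esub> \<zero>\<^bsub>HH1 A\<^esub> = ?q d"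
          using abelian_monoid.r_zero[OF abelian_group.axioms(1)[OF A.HH.Q.abelian_group_quotient]] d(1)
          by (simp add: A.HH.Q.carrier_quotient)
        finally show ?thesis .
      qed
      ultimately show "C \<in> ?q ` Fil 0" using d(2) by (metis imageI)
    qed
    fix n C D assume "C \<in> ?q ` Fil n" "D \<in> ?q ` Fil n"
    then obtain x y where xy: "x \<in> Fil n" "C = ?q x" "y \<in> Fil n" "D = ?q y" by auto
    have "bracket ?D x y \<in> Fil (Suc n)"
    \<comment> \<open>For n = 0 the general bound \<open>Fil (n + n)\<close> gives no progress, so
      the diagonal form is used; for positive n it already lies in
      \<open>Fil (Suc n)\<close>.\<close>
    proof (cases n)
      case 0
      then have "x \<in> Fil 0" "y \<in> Fil 0" using xy(1,3) by auto
      then have "bracket ?D x y \<in> Fil 1" by (intro bracket_Fil_0 par)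
      then show ?thesis using 0 by (simp only: One_nat_def)
    next
      case (Suc k)
      then have le: "Suc n \<le> n + n" by simp
      show ?thesis by (rule subsetD[OF Fil_mono[OF le] bracket_Fil[OF xy(1,3)]])
    qed
    moreover have "x \<in> derivations A" "y \<in> derivations A" using xy by (auto simp: Fil_def)
    then have "bracket (HH1 A) C D = ?q (bracket ?D x y)"
      unfolding xy by (intro A.HH.bracket_quotient) simp_all
    ultimately show "bracket (HH1 A) C D \<in> ?q ` Fil (Suc n)" by (metis imageI)
  qed
qed

end

theorem theorem1p2:
  fixes Q :: "('v, 'e) pre_digraph"
    and I :: "(('v, 'e) qpath \<Rightarrow> 'k::alg_closed_field) set"
    and A :: "('k, ('v, 'e, 'k) bqa_elem) module"
    and r :: "('v, 'e) qpath rel"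
  assumes quiver: "fin_digraph Q"
    and admissible: "admissible_ideal Q I"
    and A: "A = bound_quiver_algebra Q I"
    and finite_dim: "vs_dim A < \<infinity>"
    and ext: "\<And>(S :: (('v, 'e, 'k) bqa_elem, ('v, 'e, 'k) bqa_elem) module)
               (T :: (('v, 'e, 'k) bqa_elem, ('v, 'e, 'k) bqa_elem) module).
                simple_module A S \<Longrightarrow> simple_module A T \<Longrightarrow> vs_dim (Ext1 A S T) \<le> 1"
    and order: "linear_order_on (paths Q) r"
    and Sigma0_empty: "Sigma0 Q I r = {}"
  shows "solvable_lie_algebra (HH1 A)"
proof -
  interpret bound_quiver Q I
    using quiver admissible by (intro bound_quiver.intro bound_quiver_axioms.intro)
  show ?thesis
    unfolding A using order Sigma0_empty no_parallel_arrows[OF ext[unfolded A]]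
    by (intro solvable_HH1) blast+
qed

end
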